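(* Let $A:\hat\Sigma\to\mathbb{R}$ be a Hölder observable. Assume that $\Omega(A)$ is a finite union of disjoint irreducible components, $\Omega(A)=\bigsqcup_{i=1}^r C_i$. Fix $\bar{\mathbf{x}}^1\in C_1,\ldots,\bar{\mathbf{x}}^r\in C_r$ and let $$\mathcal{C}_A(\bar{\mathbf{x}}^1,\ldots,\bar{\mathbf{x}}^r)=\{(u_1,\ldots,u_r)\in\mathbb{R}^r : u_j-u_i\le h_A(\bar{\mathbf{x}}^i,\bar{\mathbf{x}}^j)\ \ \forall\, i,j\}.$$ 1. If $u$ is a continuous calibrated sub-action for $A$ and $u_i:=u(\bar{\mathbf{x}}^i)$ for $i=1,\ldots,r$, then $(u_1,\ldots,u_r)\in\mathcal{C}_A(\bar{\mathbf{x}}^1,\ldots,\bar{\mathbf{x}}^r)$ and $u(\mathbf{x})=\min_{1\le i\le r}[u(\bar{\mathbf{x}}^i)+h_A(\bar{\mathbf{x}}^i,\mathbf{x})]$ for all $\mathbf{x}\in\Sigma$. 2. If $(u_1,\ldots,u_r)\in\mathcal{C}_A(\bar{\mathbf{x}}^1,\ldots,\bar{\mathbf{x}}^r)$ and $u(\mathbf{x}):=\min_{1\le i\le r}[u_i+h_A(\bar{\mathbf{x}}^i,\mathbf{x})]$ for $\mathbf{x}\in\Sigma$, then $u$ is a continuous calibrated sub-action for $A$ satisfying $u(\bar{\mathbf{x}}^i)=u_i$ for all $i=1,\ldots,r$. 3. Let $i_0\in\{1,\ldots,r\}$ and let $(u_1,\ldots,u_r)\in\mathbb{R}^r$ be such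 that $u_i=u_{i_0}+h_A(\bar{\mathbf{x}}^{i_0},\bar{\mathbf{x}}^i)$ for all $i=1,\ldots,r$. Then $i_0$ is the unique index with this property, $(u_1,\ldots,u_r)\in\mathcal{C}_A(\bar{\mathbf{x}}^1,\ldots,\bar{\mathbf{x}}^r)$, and the unique calibrated sub-action $u$ satisfying $u(\bar{\mathbf{x}}^i)=u_i$ for all $i=1,\ldots,r$ is $u(\mathbf{x})=u_{i_0}+h_A(\bar{\mathbf{x}}^{i_0},\mathbf{x})$.
   Context: Subshift. Let $\mathbf{M}$ be an irreducible $s\times s$ transition matrix with entries in $\{0,1\}$, let $\Sigma=\{\mathbf{x}=(x_0,x_1,\ldots)\in\{1,\ldots,s\}^{\mathbb{N}} : \mathbf{M}(x_j,x_{j+1})=1\ \forall j\ge 0\}$ be the associated one-sided transitive subshift of finite type, and let $\sigma(x_0,x_1,\ldots)=(x_1,x_2,\ldots)$. Fix $\lambda\in(0,1)$; $\Sigma$ carries the metric $d(\mathbf{x},\bar{\mathbf{x}})=\lambda^{k}$, $k=\min\{j:x_j\neq\bar x_j\}$ (and $d(\mathbf{x},\mathbf{x})=0$). Let $\Sigma^*=\{\mathbf{y}=(\ldots,y_2,y_1)\in\{1,\ldots,s\}^{\{1,2,\ldots\}} : \mathbf{M}(y_{j+1},y_j)=1\ \forall j\ge1\}$ with the analogous metric. Put $\Sigma^*_{\mathbf{x}}=\{\mathbf{y}\in\Sigma^*:\mathbf{M}(y_1,x_0)=1\}$ and $\hat\Sigma=\{(\mathbf{y},\mathbf{x})\in\Sigma^*\times\Sigma:\mathbf{y}\in\Sigma^*_{\mathbf{x}}\}$,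 with the maximum metric. For $(\mathbf{y},\mathbf{x})\in\hat\Sigma$ put $\tau_{\mathbf{y}}(\mathbf{x})=(y_1,x_0,x_1,\ldots)\in\Sigma$. Holonomic minimizing value. $\hat{\mathcal{M}}_{\rm hol}$ is the set of Borel probability measures $\hat\mu$ on $\hat\Sigma$ with $\int f(\tau_{\mathbf{y}}(\mathbf{x}))\,d\hat\mu(\mathbf{y},\mathbf{x})=\int f(\mathbf{x})\,d\hat\mu(\mathbf{y},\mathbf{x})$ for all $f\in C^0(\Sigma)$. For an observable $A:\hat\Sigma\to\mathbb{R}$, $\bar A=\min\{\int A\,d\hat\mu:\hat\mu\in\hat{\mathcal{M}}_{\rm hol}\}$. Sub-actions. A sub-action for $A$ is a continuous $u:\Sigma\to\mathbb{R}$ with $u(\mathbf{x})-u(\tau_{\mathbf{y}}(\mathbf{x}))\le A(\mathbf{y},\mathbf{x})-\bar A$ for all $(\mathbf{y},\mathbf{x})\in\hat\Sigma$. It is calibrated if $u(\mathbf{x})=\min_{\mathbf{y}\in\Sigma^*_{\mathbf{x}}}[u(\tau_{\mathbf{y}}(\mathbf{x}))+A(\mathbf{y},\mathbf{x})-\bar A]$ for all $\mathbf{x}\in\Sigma$. Paths, non-wandering set, Peierls barrier. A path of length $k$ is a sequence $(\mathbf{z}^0,\ldots,\mathbf{z}^k)$ in $\hat\Sigma$, $\mathbf{z}^i=(\mathbf{y}^i,\mathbf{x}^i)$, with $\mathbf{x}^i=\tau_{\mathbf{y}^{i+1}}(\mathbf{x}^{i+1})$ for $0\le i\le k-1$. $\mathcal{P}_k(\mathbf{x},\bar{\mathbf{x}},\epsilon)$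 is the set of paths of length $k$ with $d(\mathbf{x}^0,\mathbf{x})<\epsilon$ and $d(\mathbf{x}^k,\bar{\mathbf{x}})<\epsilon$. $\Omega(A)$ is the set of $\mathbf{x}\in\Sigma$ such that for every $\epsilon>0$ there are $k\ge1$ and $(\mathbf{z}^0,\ldots,\mathbf{z}^k)\in\mathcal{P}_k(\mathbf{x},\mathbf{x},\epsilon)$ with $\big|\sum_{i=1}^k(A-\bar A)(\mathbf{z}^i)\big|<\epsilon$. For $\epsilon>0$, $k\ge1$, let $S_A^\epsilon(\mathbf{x},\bar{\mathbf{x}},k)=\inf\{\sum_{i=1}^k(A-\bar A)(\mathbf{z}^i):(\mathbf{z}^0,\ldots,\mathbf{z}^k)\in\mathcal{P}_k(\mathbf{x},\bar{\mathbf{x}},\epsilon)\}$ ($\inf\emptyset=+\infty$). The Peierls barrier $h_A:\Sigma\times\Sigma\to\mathbb{R}\cup\{+\infty\}$ is $h_A(\mathbf{x},\bar{\mathbf{x}})=\lim_{\epsilon\to0}\liminf_{k\to+\infty}S_A^\epsilon(\mathbf{x},\bar{\mathbf{x}},k)$. Irreducible components. On $\Omega(A)$, the relation $\mathbf{x}\sim\bar{\mathbf{x}}\Leftrightarrow h_A(\mathbf{x},\bar{\mathbf{x}})+h_A(\bar{\mathbf{x}},\mathbf{x})=0$ is an equivalence relation; its equivalence classes are called irreducible components. *)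

theory Defs
  imports "HOL-Probability.Probability"
begin

(* The alphabet {1..s} is the finite type 's (s = CARD('s)).  A point of the one-sided
   shift is x :: nat => 's.  A past (..., y_2, y_1) is also a function on nat, shifted by
   one: y j stands for y_(j+1).  In particular y 0 is the symbol y_1 next to x_0. *)

type_synonym 's seq = "nat \<Rightarrow> 's"

definition transition_matrix :: "nat^'s^'s::finite \<Rightarrow> bool" where
  "transition_matrix M \<longleftrightarrow> (\<forall>i j. M $ i $ j \<in> {0, 1})"

definition irreducible_matrix :: "nat^'s^'s::finite \<Rightarrow> bool" where
  "irreducible_matrix M \<longleftrightarrow> (\<forall>i j. \<exists>n\<ge>1. (((**) M ^^ n) (mat 1)) $ i $ j > 0)"

definition shift_space :: "nat^'s^'s::finite \<Rightarrow> 's seq set" where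
  "shift_space M = {x. \<forall>j. M $ (x j) $ (x (Suc j)) = 1}"

definition past_space :: "nat^'s^'s::finite \<Rightarrow> 's seq set" where
  "past_space M = {y. \<forall>j. M $ (y (Suc j)) $ (y j) = 1}"

definition pasts_of :: "nat^'s^'s::finite \<Rightarrow> 's seq \<Rightarrow> 's seq set" where
  "pasts_of M x = {y \<in> past_space M. M $ (y 0) $ (x 0) = 1}"

definition hat_space :: "nat^'s^'s::finite \<Rightarrow> ('s seq \<times> 's seq) set" where
  "hat_space M = {(y, x). x \<in> shift_space M \<and> y \<in> pasts_of M x}"

definition tau :: "'s seq \<Rightarrow> 's seq \<Rightarrow> 's seq" where
  "tau y x = case_nat (y 0) x"

definition shift_dist :: "real \<Rightarrow> 's seq \<Rightarrow> 's seq \<Rightarrow> real" where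
  "shift_dist lam x x' = (if x = x' then 0 else lam ^ (LEAST j. x j \<noteq> x' j))"

(* the exponent is the least index k >= 1 with y_k \<noteq> y'_k, hence the Suc *)
definition past_dist :: "real \<Rightarrow> 's seq \<Rightarrow> 's seq \<Rightarrow> real" where
  "past_dist lam y y' = (if y = y' then 0 else lam ^ Suc (LEAST j. y j \<noteq> y' j))"

definition hat_dist :: "real \<Rightarrow> 's seq \<times> 's seq \<Rightarrow> 's seq \<times> 's seq \<Rightarrow> real" where
  "hat_dist lam z z' = max (past_dist lam (fst z) (fst z')) (shift_dist lam (snd z) (snd z'))"

definition shift_topology :: "nat^'s^'s::finite \<Rightarrow> real \<Rightarrow> 's seq topology" where
  "shift_topology M lam = Metric_space.mtopology (shift_space M) (shift_dist lam)"

definition hat_topology :: "nat^'s^'s::finite \<Rightarrow> real \<Rightarrow> ('s seq \<times> 's seq) topology" where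
  "hat_topology M lam = Metric_space.mtopology (hat_space M) (hat_dist lam)"

definition hat_borel :: "nat^'s^'s::finite \<Rightarrow> real \<Rightarrow> ('s seq \<times> 's seq) measure" where
  "hat_borel M lam = sigma (hat_space M) {U. openin (hat_topology M lam) U}"

definition continuous_on_shift ::
    "nat^'s^'s::finite \<Rightarrow> real \<Rightarrow> ('s seq \<Rightarrow> real) \<Rightarrow> bool" where
  "continuous_on_shift M lam f \<longleftrightarrow> continuous_map (shift_topology M lam) euclideanreal f"

definition holder_observable ::
    "nat^'s^'s::finite \<Rightarrow> real \<Rightarrow> ('s seq \<times> 's seq \<Rightarrow> real) \<Rightarrow> bool" where
  "holder_observable M lam A \<longleftrightarrow>
     (\<exists>\<alpha> K. 0 < \<alpha> \<and> \<alpha> \<le> 1 \<and>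
        (\<forall>z\<in>hat_space M. \<forall>z'\<in>hat_space M. \<bar>A z - A z'\<bar> \<le> K * hat_dist lam z z' powr \<alpha>))"

definition holonomic_measures ::
    "nat^'s^'s::finite \<Rightarrow> real \<Rightarrow> ('s seq \<times> 's seq) measure set" where
  "holonomic_measures M lam = {\<mu>. prob_space \<mu> \<and> sets \<mu> = sets (hat_borel M lam) \<and>
     (\<forall>f. continuous_on_shift M lam f \<longrightarrow>
        (\<integral>(y, x). f (tau y x) \<partial>\<mu>) = (\<integral>(y, x). f x \<partial>\<mu>))}"

(* For continuous A the infimum is attained, by weak-* compactness, so it is the minimum. *)
definition min_value ::
    "nat^'s^'s::finite \<Rightarrow> real \<Rightarrow> ('s seq \<times> 's seq \<Rightarrow> real) \<Rightarrow> real" where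
  "min_value M lam A = (INF \<mu>\<in>holonomic_measures M lam. \<integral>z. A z \<partial>\<mu>)"

definition sub_action ::
    "nat^'s^'s::finite \<Rightarrow> real \<Rightarrow> ('s seq \<times> 's seq \<Rightarrow> real) \<Rightarrow> ('s seq \<Rightarrow> real) \<Rightarrow> bool" where
  "sub_action M lam A u \<longleftrightarrow> continuous_on_shift M lam u \<and>
     (\<forall>(y, x)\<in>hat_space M. u x - u (tau y x) \<le> A (y, x) - min_value M lam A)"

definition is_minimum :: "real \<Rightarrow> real set \<Rightarrow> bool" where
  "is_minimum m S \<longleftrightarrow> m \<in> S \<and> (\<forall>s\<in>S. m \<le> s)"

definition calibrated_sub_action ::
    "nat^'s^'s::finite \<Rightarrow> real \<Rightarrow> ('s seq \<times> 's seq \<Rightarrow> real) \<Rightarrow> ('s seq \<Rightarrow> real) \<Rightarrow> bool" where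
  "calibrated_sub_action M lam A u \<longleftrightarrow> sub_action M lam A u \<and>
     (\<forall>x\<in>shift_space M.
        is_minimum (u x) ((\<lambda>y. u (tau y x) + A (y, x) - min_value M lam A) ` pasts_of M x))"

(* z 0, ..., z k is a path of length k; the values of z beyond k are irrelevant. *)
definition is_path ::
    "nat^'s^'s::finite \<Rightarrow> nat \<Rightarrow> (nat \<Rightarrow> 's seq \<times> 's seq) \<Rightarrow> bool" where
  "is_path M k z \<longleftrightarrow> (\<forall>i\<le>k. z i \<in> hat_space M) \<and>
     (\<forall>i<k. snd (z i) = tau (fst (z (Suc i))) (snd (z (Suc i))))"

definition paths ::
    "nat^'s^'s::finite \<Rightarrow> real \<Rightarrow> nat \<Rightarrow> 's seq \<Rightarrow> 's seq \<Rightarrow> real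
       \<Rightarrow> (nat \<Rightarrow> 's seq \<times> 's seq) set" where
  "paths M lam k x x' \<epsilon> = {z. is_path M k z \<and>
     shift_dist lam (snd (z 0)) x < \<epsilon> \<and> shift_dist lam (snd (z k)) x' < \<epsilon>}"

definition action ::
    "nat^'s^'s::finite \<Rightarrow> real \<Rightarrow> ('s seq \<times> 's seq \<Rightarrow> real) \<Rightarrow> nat
       \<Rightarrow> (nat \<Rightarrow> 's seq \<times> 's seq) \<Rightarrow> real" where
  "action M lam A k z = (\<Sum>i=1..k. A (z i) - min_value M lam A)"

definition nonwandering ::
    "nat^'s^'s::finite \<Rightarrow> real \<Rightarrow> ('s seq \<times> 's seq \<Rightarrow> real) \<Rightarrow> 's seq set" where
  "nonwandering M lam A = {x \<in> shift_space M.
     \<forall>\<epsilon>>0. \<exists>k\<ge>1. \<exists>z\<in>paths M lam k x x \<epsilon>. \<bar>action M lam A k z\<bar> < \<epsilon>}"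

definition S_eps ::
    "nat^'s^'s::finite \<Rightarrow> real \<Rightarrow> ('s seq \<times> 's seq \<Rightarrow> real) \<Rightarrow> real
       \<Rightarrow> 's seq \<Rightarrow> 's seq \<Rightarrow> nat \<Rightarrow> ereal" where
  "S_eps M lam A \<epsilon> x x' k = (INF z\<in>paths M lam k x x' \<epsilon>. ereal (action M lam A k z))"

(* S_eps, hence its liminf, is monotone in \<epsilon>, so the limit exists in ereal. *)
definition peierls ::
    "nat^'s^'s::finite \<Rightarrow> real \<Rightarrow> ('s seq \<times> 's seq \<Rightarrow> real) \<Rightarrow> 's seq \<Rightarrow> 's seq \<Rightarrow> ereal" where
  "peierls M lam A x x' = Lim (at_right 0) (\<lambda>\<epsilon>. liminf (\<lambda>k. S_eps M lam A \<epsilon> x x' k))"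

definition irreducible_components ::
    "nat^'s^'s::finite \<Rightarrow> real \<Rightarrow> ('s seq \<times> 's seq \<Rightarrow> real) \<Rightarrow> 's seq set set" where
  "irreducible_components M lam A = nonwandering M lam A //
     {(x, x'). x \<in> nonwandering M lam A \<and> x' \<in> nonwandering M lam A \<and>
        peierls M lam A x x' + peierls M lam A x' x = 0}"

(* Vectors (u_1, ..., u_r) are functions on nat; only the values at 1..r matter. *)
definition constraint_set ::
    "nat^'s^'s::finite \<Rightarrow> real \<Rightarrow> ('s seq \<times> 's seq \<Rightarrow> real) \<Rightarrow> nat \<Rightarrow> (nat \<Rightarrow> 's seq)
       \<Rightarrow> (nat \<Rightarrow> real) set" where
  "constraint_set M lam A r xb =
     {w. \<forall>i\<in>{1..r}. \<forall>j\<in>{1..r}. ereal (w j - w i) \<le> peierls M lam A (xb i) (xb j)}"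

end

theory Submission
  imports Defs
begin

text \<open>Along a path every point is the shift of the preceding one, and only the first symbol of each
  past is prescribed. Minimizing \<open>A\<close> over the remaining symbols gives a Hoelder observable \<open>B\<close> on
  the one-sided shift, and the Peierls barrier becomes a limit of Birkhoff sums of \<open>B\<close> minus the
  minimizing value. Closing orbits up to periodic ones bounds these sums below; conversely a constant
  with this property cannot exceed the minimizing value. Hence long orbits of bounded cost exist, and
  the liminf of the cost of reaching \<open>x\<close> is a calibrated sub-action in \<open>x\<close>, also when the starting
  points have to approach a given non-wandering point, in which case it is the Peierls barrier.
  Following the calibration of a sub-action backwards leads to a non-wandering point, which can be
  replaced by the representative of its component. This gives the representation formula, and the
  rest is the triangle inequality for the barrier.\<close>

section \<open>The shift metric\<close>

text \<open>The minimizing value is an infimum over measures, the barrier a limit of sums along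
  finite paths. The link is that \<open>m\<close> is the largest constant \<open>c\<close> for which
  the sums \<open>S c k w\<close> have a common lower bound. For \<open>c = m\<close> the bound
  comes from the holonomic measures carried by periodic orbits; conversely, a lower bound for
  \<open>c\<close> yields a continuous sub-action, and integrating it against holonomic measures
  gives \<open>c \<le> m\<close>. \<open>M\<close> is only irreducible: two symbols are joined by a
  word of length at most \<open>gap\<close>, not of prescribed length. Joining words therefore
  changes lengths and sums by bounded amounts, which is enough for finiteness and for lower bounds.
  Paths meet both of their ends only approximately. Replacing the tail of an orbit by a point that
  agrees with it in \<open>n\<close> symbols costs at most \<open>D * \<theta> ^ n\<close>, whatever
  the length of the orbit, where \<open>D = K / (1 - \<theta>)\<close> is the sum of a geometric
  series of Hoelder errors. So the final point can be made exact and only the starting condition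
  stays approximate; hence the shape of \<open>cost\<close>.\<close>

definition agree :: "nat \<Rightarrow> 'a seq \<Rightarrow> 'a seq \<Rightarrow> bool" where
  "agree n x y \<longleftrightarrow> (\<forall>j<n. x j = y j)"

definition shiftn :: "nat \<Rightarrow> 'a seq \<Rightarrow> 'a seq" where
  "shiftn k x = (\<lambda>j. x (j + k))"

text \<open>The word in front is a prefix of a full sequence \<open>p\<close>, so prefixes of points
  and connecting words share one operation. Admissibility at the joint then reads
  \<open>p k = x 0\<close>: \<open>x\<close> begins with the symbol that \<open>p\<close> would have
  had next.\<close>

definition glue :: "nat \<Rightarrow> 'a seq \<Rightarrow> 'a seq \<Rightarrow> 'a seq" where
  "glue k p x = (\<lambda>j. if j < k then p j else x (j - k))"

lemma agree_refl [simp]: "agree n x x"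
  by (simp add: agree_def)

lemma agree_0 [simp]: "agree 0 x y"
  by (simp add: agree_def)

lemma agree_sym: "agree n x y \<Longrightarrow> agree n y x"
  by (simp add: agree_def)

lemma agree_trans: "agree n x y \<Longrightarrow> agree n y z \<Longrightarrow> agree n x z"
  by (simp add: agree_def)

lemma agree_mono: "agree n x y \<Longrightarrow> m \<le> n \<Longrightarrow> agree m x y"
  by (simp add: agree_def)

lemma shiftn_0 [simp]: "shiftn 0 x = x"
  by (simp add: shiftn_def)

lemma shiftn_shiftn [simp]: "shiftn k (shiftn l x) = shiftn (k + l) x"
  by (simp add: shiftn_def add.assoc)

lemma agree_shiftn: "agree (n + k) x y \<Longrightarrow> agree n (shiftn k x) (shiftn k y)"
  by (simp add: agree_def shiftn_def)

lemma shiftn_glue [simp]: "shiftn k (glue k p x) = x"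
  by (simp add: shiftn_def glue_def)

text \<open>The old and the new tail share \<open>n\<close> symbols, so the change is invisible
  before position \<open>k + n\<close>. This is the hypothesis of
  \<open>S_distortion\<close>.\<close>

lemma agree_glue: "agree n (shiftn k p) x \<Longrightarrow> agree (k + n) (glue k p x) p"
  unfolding agree_def shiftn_def glue_def by (auto simp: not_less) (metis add.commute le_add_diff_inverse2 less_diff_conv2 nat_add_left_cancel_less)

lemma agree_glue_prefix: "agree k (glue k p x) p"
  by (simp add: agree_def glue_def)

lemma shiftn_tau [simp]: "shiftn (Suc 0) (tau y x) = x"
  by (simp add: shiftn_def tau_def)

lemma tau_shiftn: "y 0 = x 0 \<Longrightarrow> tau y (shiftn (Suc 0) x) = x"
  by (auto simp: shiftn_def tau_def split: nat.split)

lemma agree_tau: "agree n y y' \<Longrightarrow> agree n x x' \<Longrightarrow> agree n (tau y x) (tau y' x')"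
  by (auto simp: agree_def tau_def split: nat.split)

text \<open>Compactness of the full shift, by repeated pigeonhole: a prefix shared by infinitely
  many terms extends by some symbol to another such prefix. Later arguments use the infinite index
  sets in place of a convergent subsequence.\<close>

lemma cluster_point:
  fixes f :: "nat \<Rightarrow> nat \<Rightarrow> 'a::finite"
  shows "\<exists>p. \<forall>n. infinite {k. agree n (f k) p}"
proof -
  have "\<exists>P. \<forall>n. infinite {k. agree n (f k) (P n)} \<and> agree n (P (Suc n)) (P n)"
  proof (rule dependent_nat_choice)
    show "\<exists>x. infinite {k. agree 0 (f k) x}" by simp
  next
    fix x n assume inf: "infinite {k. agree n (f k) x}"
    have "{k. agree n (f k) x} = (\<Union>a. {k. agree n (f k) x \<and> f k n = a})" by auto
    moreover have "finite (UNIV :: 'a set)" by simp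
    ultimately obtain a where a: "infinite {k. agree n (f k) x \<and> f k n = a}"
      using inf by (metis (no_types, lifting) finite_UN)
    have "{k. agree n (f k) x \<and> f k n = a} \<subseteq> {k. agree (Suc n) (f k) (x(n := a))}"
      by (auto simp: agree_def less_Suc_eq)
    then have "infinite {k. agree (Suc n) (f k) (x(n := a))}"
      using a infinite_super by blast
    moreover have "agree n (x(n := a)) x" by (simp add: agree_def)
    ultimately show "\<exists>y. infinite {k. agree (Suc n) (f k) y} \<and> agree n y x" by blast
  qed
  then obtain P where P: "\<And>n. infinite {k. agree n (f k) (P n)}" "\<And>n. agree n (P (Suc n)) (P n)"
    by blast
  have mono: "agree n (P (n + m)) (P n)" for n m
  proof (induction m)
    case (Suc m)
    have "agree n (P (Suc (n + m))) (P (n + m))" using P(2) agree_mono le_add1 by blast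
    then show ?case using Suc agree_trans by fastforce
  qed simp
  \<comment> \<open>Diagonal choice: \<open>P (Suc j)\<close> is the first of the prefixes on which
    symbol \<open>j\<close> is fixed.\<close>
  define p where "p = (\<lambda>j. P (Suc j) j)"
  have "agree n p (P n)" for n
    unfolding agree_def
  proof (intro allI impI)
    fix j assume "j < n"
    then obtain m where "n = Suc j + m" by (metis Suc_leI le_iff_add)
    then show "p j = P n j"
      using mono[of "Suc j" m] by (simp add: p_def agree_def)
  qed
  then have "{k. agree n (f k) (P n)} \<subseteq> {k. agree n (f k) p}" for n
    using agree_trans agree_sym by blast
  then show ?thesis using P(1) infinite_super by meson
qed

text \<open>Distances are powers of \<open>lam\<close> with the first disagreement as exponent, so
  closed balls of radius \<open>lam ^ n\<close> are cylinders. From here on closeness is expressed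
  by \<open>agree\<close>.\<close>

lemma shift_dist_le_iff:
  assumes "0 < lam" "lam < 1"
  shows "shift_dist lam x y \<le> lam ^ n \<longleftrightarrow> agree n x y"
proof (cases "x = y")
  case False
  define l where "l = (LEAST j. x j \<noteq> y j)"
  from False have "\<exists>j. x j \<noteq> y j" by blast
  then have "x l \<noteq> y l" unfolding l_def by (rule LeastI_ex)
  moreover have "x j = y j" if "j < l" for j
    using that not_less_Least unfolding l_def by blast
  ultimately have "agree n x y \<longleftrightarrow> n \<le> l"
    unfolding agree_def by (metis leI le_less_trans linorder_not_less)
  moreover have "shift_dist lam x y = lam ^ l"
    using False by (simp add: shift_dist_def l_def)
  ultimately show ?thesis using assms by (simp add: power_decreasing_iff)
qed (use assms in \<open>simp add: shift_dist_def\<close>)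

lemma shift_dist_lt_imp_agree:
  assumes "0 < lam" "lam < 1" "shift_dist lam x y < lam ^ n"
  shows "agree n x y"
  using shift_dist_le_iff[OF assms(1,2)] assms(3) less_imp_le by blast

lemma shift_dist_lt_if_agree:
  assumes "0 < lam" "lam < 1" "0 < e"
  obtains n where "\<And>x y :: 'a seq. agree n x y \<Longrightarrow> shift_dist lam x y < e"
  by (metis assms le_less_trans real_arch_pow_inv shift_dist_le_iff)

lemma past_dist_eq: "past_dist lam y y' = lam * shift_dist lam y y'"
  by (simp add: past_dist_def shift_dist_def)

lemma shift_dist_nonneg: "0 < lam \<Longrightarrow> 0 \<le> shift_dist lam x y"
  by (simp add: shift_dist_def)

lemma shift_dist_commute: "shift_dist lam x y = shift_dist lam y x"
  unfolding shift_dist_def by (simp add: eq_commute)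

lemma shift_dist_eq_0: "0 < lam \<Longrightarrow> shift_dist lam x y = 0 \<longleftrightarrow> x = y"
  by (simp add: shift_dist_def)

lemma shift_dist_triangle:
  assumes "0 < lam" "lam < 1"
  shows "shift_dist lam x z \<le> shift_dist lam x y + shift_dist lam y z"
proof (cases "x = y \<or> y = z")
  case True
  then show ?thesis using assms by (auto simp: shift_dist_def)
next
  case False
  define m where "m = (LEAST j. x j \<noteq> y j)"
  define n where "n = (LEAST j. y j \<noteq> z j)"
  have d: "shift_dist lam x y = lam ^ m" "shift_dist lam y z = lam ^ n"
    using False by (simp_all add: shift_dist_def m_def n_def)
  then have "agree m x y" "agree n y z"
    using shift_dist_le_iff[OF assms] by (metis order_refl)+
  then have "agree (min m n) x z" using agree_mono agree_trans
    by (metis min.cobounded1 min.cobounded2)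
  then have "shift_dist lam x z \<le> lam ^ min m n" using shift_dist_le_iff[OF assms] by blast
  also have "\<dots> \<le> lam ^ m + lam ^ n" using assms by (simp add: min_def)
  finally show ?thesis by (simp add: d)
qed

lemma Metric_space_shift:
  assumes "0 < lam" "lam < 1"
  shows "Metric_space X (shift_dist lam)"
  using shift_dist_nonneg shift_dist_commute shift_dist_eq_0 shift_dist_triangle assms
  by unfold_locales blast+

lemma Metric_space_hat:
  assumes "0 < lam" "lam < 1"
  shows "Metric_space X (hat_dist lam)"
proof
  fix z z' z'' :: "'a seq \<times> 'a seq"
  show "0 \<le> hat_dist lam z z'"
    using shift_dist_nonneg[of lam "snd z" "snd z'"] assms by (simp add: hat_dist_def le_max_iff_disj)
  show "hat_dist lam z z' = hat_dist lam z' z"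
    by (simp add: hat_dist_def past_dist_eq shift_dist_commute)
  have max0: "max a b = 0 \<longleftrightarrow> a = 0 \<and> b = 0" if "0 \<le> a" "0 \<le> b" for a b :: real
    using that by linarith
  have "hat_dist lam z z' = 0 \<longleftrightarrow> shift_dist lam (fst z) (fst z') = 0 \<and> shift_dist lam (snd z) (snd z') = 0"
    using assms by (simp add: hat_dist_def past_dist_eq max0 shift_dist_nonneg)
  then show "hat_dist lam z z' = 0 \<longleftrightarrow> z = z'"
    using assms by (simp add: shift_dist_eq_0 prod_eq_iff)
  have "lam * shift_dist lam (fst z) (fst z'') \<le> lam * shift_dist lam (fst z) (fst z') + lam * shift_dist lam (fst z') (fst z'')"
    using shift_dist_triangle[OF assms] assms by (simp flip: distrib_left)
  then show "hat_dist lam z z'' \<le> hat_dist lam z z' + hat_dist lam z' z''"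
    unfolding hat_dist_def past_dist_eq
    using shift_dist_triangle[OF assms, of "snd z" "snd z''" "snd z'"] by linarith
qed

lemma (in Metric_space) continuous_map_real_iff:
  "continuous_map mtopology euclideanreal f \<longleftrightarrow>
    (\<forall>x\<in>M. \<forall>e>0. \<exists>\<delta>>0. \<forall>y\<in>M. d x y < \<delta> \<longrightarrow> \<bar>f x - f y\<bar> < (e::real))"
  using metric_continuous_map[OF Met_TC.Metric_space_axioms, of f]
  by (simp add: dist_real_def Ball_def imp_conjL)

lemma continuous_on_shift_iff:
  assumes "0 < lam" "lam < 1"
  shows "continuous_on_shift M lam f \<longleftrightarrow>
    (\<forall>x\<in>shift_space M. \<forall>e>0. \<exists>n. \<forall>y\<in>shift_space M. agree n x y \<longrightarrow> \<bar>f x - f y\<bar> < e)"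
  (is "?L \<longleftrightarrow> ?R")
proof -
  interpret Metric_space "shift_space M" "shift_dist lam" using Metric_space_shift[OF assms] .
  show ?thesis
  proof
    assume ?L
    then show ?R
      unfolding continuous_on_shift_def shift_topology_def continuous_map_real_iff
      by (meson assms shift_dist_lt_if_agree)
  next
    assume ?R
    then show ?L
      unfolding continuous_on_shift_def shift_topology_def continuous_map_real_iff
      by (meson assms shift_dist_lt_imp_agree zero_less_power)
  qed
qed

lemma space_hat_borel [simp]: "space (hat_borel M lam) = hat_space M"
  by (simp add: hat_borel_def space_measure_of_conv)

lemma borel_measurable_hat:
  fixes f :: "'s::finite seq \<times> 's seq \<Rightarrow> real"
  assumes "0 < lam" "lam < 1"
    and cont: "\<And>z e. z \<in> hat_space M \<Longrightarrow> 0 < e \<Longrightarrow> \<exists>n. \<forall>z'\<in>hat_space M.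
      agree n (fst z) (fst z') \<longrightarrow> agree n (snd z) (snd z') \<longrightarrow> \<bar>f z - f z'\<bar> < e"
  shows "f \<in> borel_measurable (hat_borel M lam)"
proof (rule borel_measurableI)
  fix U :: "real set" assume "open U"
  interpret Metric_space "hat_space M" "hat_dist lam" using Metric_space_hat[OF assms(1,2)] .
  have "continuous_map mtopology euclideanreal f"
    unfolding continuous_map_real_iff
  proof (intro ballI allI impI)
    fix z and e :: real assume "z \<in> hat_space M" "0 < e"
    then obtain n where n: "\<forall>z'\<in>hat_space M.
        agree n (fst z) (fst z') \<longrightarrow> agree n (snd z) (snd z') \<longrightarrow> \<bar>f z - f z'\<bar> < e" using cont by blast
    \<comment> \<open>The extra power of \<open>lam\<close> is there because
      \<open>past_dist\<close> counts its indices from one.\<close>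
    have "agree n (fst z) (fst z') \<and> agree n (snd z) (snd z')" if "hat_dist lam z z' < lam ^ Suc n" for z'
    proof
      have "lam * shift_dist lam (fst z) (fst z') < lam * lam ^ n"
        using that by (simp add: hat_dist_def past_dist_eq)
      then show "agree n (fst z) (fst z')" using assms shift_dist_lt_imp_agree by fastforce
      have "shift_dist lam (snd z) (snd z') < lam ^ Suc n"
        using that by (simp add: hat_dist_def)
      then show "agree n (snd z) (snd z')" using assms(1,2) shift_dist_lt_imp_agree agree_mono
        by (metis lessI less_imp_le)
    qed
    then show "\<exists>\<delta>>0. \<forall>z'\<in>hat_space M. hat_dist lam z z' < \<delta> \<longrightarrow> \<bar>f z - f z'\<bar> < e"
      using n assms(1) by (meson zero_less_power)
  qed
  then have "openin mtopology {z \<in> hat_space M. f z \<in> U}"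
    using \<open>open U\<close> by (simp add: continuous_map_def)
  moreover have "f -` U \<inter> space (hat_borel M lam) = {z \<in> hat_space M. f z \<in> U}" by auto
  moreover have "{U. openin (hat_topology M lam) U} \<subseteq> Pow (hat_space M)"
    using openin_subset by (fastforce simp: hat_topology_def)
  ultimately show "f -` U \<inter> space (hat_borel M lam) \<in> sets (hat_borel M lam)"
    unfolding hat_borel_def by (auto simp: hat_topology_def)
qed

section \<open>Reduction to an observable on the one-sided shift\<close>

text \<open>The Hoelder condition in terms of cylinders; \<open>holder_subshift_exists\<close>
  obtains it with \<open>\<theta> = lam powr \<alpha>\<close>.\<close>

locale holder_subshift =
  fixes M :: "nat^'s^'s::finite" and lam :: real
    and A :: "'s seq \<times> 's seq \<Rightarrow> real" and K \<theta> :: real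
  assumes irr: "irreducible_matrix M" and M01: "transition_matrix M"
    and lam: "0 < lam" "lam < 1" and \<theta>: "0 < \<theta>" "\<theta> < 1" and K: "0 \<le> K"
    and holder: "\<And>z z' n. z \<in> hat_space M \<Longrightarrow> z' \<in> hat_space M \<Longrightarrow>
      agree n (fst z) (fst z') \<Longrightarrow> agree n (snd z) (snd z') \<Longrightarrow> \<bar>A z - A z'\<bar> \<le> K * \<theta> ^ n"
begin

abbreviation edge :: "'s \<Rightarrow> 's \<Rightarrow> bool" where "edge a b \<equiv> M $ a $ b = 1"
abbreviation "\<Sigma> \<equiv> shift_space M"
abbreviation "m \<equiv> min_value M lam A"

section \<open>Admissible words: gluing, connecting, closing up\<close>

lemma shift_spaceD: "w \<in> \<Sigma> \<Longrightarrow> edge (w j) (w (Suc j))"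
  by (simp add: shift_space_def)

lemma shiftn_in: "w \<in> \<Sigma> \<Longrightarrow> shiftn k w \<in> \<Sigma>"
  by (simp add: shift_space_def shiftn_def)

lemma glue_in:
  assumes "x \<in> \<Sigma>" "\<And>t. t < k \<Longrightarrow> edge (p t) (p (Suc t))" "p k = x 0"
  shows "glue k p x \<in> \<Sigma>"
  unfolding shift_space_def glue_def
proof safe
  fix j
  consider "Suc j < k" | "Suc j = k" | "j \<ge> k" by linarith
  then show "edge (if j < k then p j else x (j - k)) (if Suc j < k then p (Suc j) else x (Suc j - k))"
    using assms(2)[of j] assms(3) shift_spaceD[OF assms(1), of "j - k"]
    by cases (auto simp: Suc_diff_le)
qed

lemma glue_in_agree:
  assumes "x \<in> \<Sigma>" "w \<in> \<Sigma>" "agree n (shiftn k w) x" "0 < n"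
  shows "glue k w x \<in> \<Sigma>"
  using assms by (intro glue_in) (auto simp: agree_def shiftn_def shift_space_def)

lemma closed_shift: "(\<And>n. \<exists>w\<in>\<Sigma>. agree n w p) \<Longrightarrow> p \<in> \<Sigma>"
  unfolding shift_space_def agree_def by (safe, metis (mono_tags, lifting) lessI less_SucI mem_Collect_eq)

text \<open>Entries of a matrix power count admissible words, and a positive sum over the second
  symbol has a positive term.\<close>

lemma word_exists:
  "0 < (((**) M ^^ n) (mat 1)) $ i $ j \<Longrightarrow>
    \<exists>q. q 0 = i \<and> q n = j \<and> (\<forall>t<n. edge (q t) (q (Suc t)))"
proof (induction n arbitrary: i)
  case 0
  then have "i = j" by (simp add: mat_def split: if_splits)
  then show ?case by (intro exI[of _ "\<lambda>_. i"]) simp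
next
  case (Suc n)
  have "(((**) M ^^ Suc n) (mat 1)) $ i $ j = (\<Sum>k\<in>UNIV. M $ i $ k * (((**) M ^^ n) (mat 1)) $ k $ j)"
    by (simp add: matrix_matrix_mult_def)
  with Suc.prems obtain k where "0 < M $ i $ k * (((**) M ^^ n) (mat 1)) $ k $ j"
    by (metis (no_types, lifting) neq0_conv sum.neutral)
  then have k: "M $ i $ k \<noteq> 0" "0 < (((**) M ^^ n) (mat 1)) $ k $ j" by auto
  then have ik: "edge i k" using M01 unfolding transition_matrix_def by (metis insertE singletonD)
  obtain q where q: "q 0 = k" "q n = j" "\<forall>t<n. edge (q t) (q (Suc t))"
    using Suc.IH[OF k(2)] by blast
  have "edge (case_nat i q t) (case_nat i q (Suc t))" if "t < Suc n" for t
    using that q ik by (cases t) auto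
  then show ?case using q by (intro exI[of _ "case_nat i q"]) auto
qed

text \<open>Finiteness of the alphabet makes the length bound uniform. A common length cannot be
  demanded, since an irreducible \<open>M\<close> may be periodic.\<close>

lemma connect_bounded:
  "\<exists>L. \<forall>a b. \<exists>n q. 1 \<le> n \<and> n \<le> L \<and> q 0 = a \<and> q n = b \<and> (\<forall>t<n. edge (q t) (q (Suc t)))"
proof -
  have "\<forall>c. \<exists>n\<ge>1. \<exists>q. q 0 = fst c \<and> q n = snd c \<and> (\<forall>t<n. edge (q t) (q (Suc t)))"
    using irr word_exists unfolding irreducible_matrix_def by (metis (mono_tags, lifting))
  then obtain N where N: "\<And>c. 1 \<le> N c" "\<And>c. \<exists>q. q 0 = fst c \<and> q (N c) = snd c \<and> (\<forall>t<N c. edge (q t) (q (Suc t)))"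
    by metis
  have "N (a, b) \<le> Max (range N)" for a b by simp
  then show ?thesis using N by (metis fst_conv snd_conv)
qed

definition gap :: nat where
  "gap = (SOME L. \<forall>a b. \<exists>n q. 1 \<le> n \<and> n \<le> L \<and> q 0 = a \<and> q n = b \<and> (\<forall>t<n. edge (q t) (q (Suc t))))"

lemma connect:
  obtains n q where "1 \<le> n" "n \<le> gap" "q 0 = a" "q n = b" "\<And>t. t < n \<Longrightarrow> edge (q t) (q (Suc t))"
proof -
  have "\<forall>a b. \<exists>n q. 1 \<le> n \<and> n \<le> gap \<and> q 0 = a \<and> q n = b \<and> (\<forall>t<n. edge (q t) (q (Suc t)))"
    unfolding gap_def by (rule someI_ex) (rule connect_bounded)
  then show ?thesis using that by meson
qed

lemma connect_to:
  assumes "x \<in> \<Sigma>"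
  obtains n w where "n \<le> gap" "w \<in> \<Sigma>" "w 0 = a" "shiftn n w = x"
proof -
  obtain n q where q: "1 \<le> n" "n \<le> gap" "q 0 = a" "q n = x 0" "\<And>t. t < n \<Longrightarrow> edge (q t) (q (Suc t))"
    by (rule connect) blast
  have "glue n q x \<in> \<Sigma>" using q assms by (intro glue_in)
  moreover have "glue n q x 0 = a" using q by (simp add: glue_def)
  ultimately show ?thesis using that q shiftn_glue by blast
qed

lemma predecessor: "\<exists>b. edge b a"
proof -
  obtain n q where q: "1 \<le> n" "n \<le> gap" "q 0 = a" "q n = a" "\<And>t. t < n \<Longrightarrow> edge (q t) (q (Suc t))"
    by (rule connect) blast
  then show ?thesis by (metis One_nat_def Suc_le_D lessI)
qed

lemma past_exists: "\<exists>y\<in>past_space M. y 0 = a"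
proof -
  obtain p where p: "\<And>a. edge (p a) a" using predecessor by metis
  then have "(\<lambda>j. (p ^^ j) a) \<in> past_space M" by (simp add: past_space_def)
  then show ?thesis by (intro bexI[of _ "\<lambda>j. (p ^^ j) a"]) simp
qed

lemma preimage_exists:
  assumes "x \<in> \<Sigma>"
  shows "\<exists>w\<in>\<Sigma>. shiftn (Suc 0) w = x"
proof -
  obtain b where b: "edge b (x 0)" using predecessor by blast
  then have "tau (\<lambda>_. b) x \<in> \<Sigma>"
    using assms by (auto simp: shift_space_def tau_def split: nat.split)
  then show ?thesis using shiftn_tau by blast
qed

lemma periodic_in:
  assumes "0 < N" "q N = q 0" "\<And>t. t < N \<Longrightarrow> edge (q t) (q (Suc t))"
  shows "(\<lambda>j. q (j mod N)) \<in> \<Sigma>"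
  unfolding shift_space_def
proof safe
  fix j
  have "j mod N < N" using assms(1) by simp
  then show "edge (q (j mod N)) (q (Suc j mod N))"
    using assms(3)[of "j mod N"] assms(2) by (cases "Suc (j mod N) = N") (auto simp: mod_Suc)
qed

lemma shift_space_nonempty: "\<Sigma> \<noteq> {}"
proof -
  obtain n q where q: "1 \<le> n" "n \<le> gap" "q 0 = undefined" "q n = undefined" "\<And>t. t < n \<Longrightarrow> edge (q t) (q (Suc t))"
    by (rule connect) blast
  then show ?thesis using periodic_in[of n q] by auto
qed

section \<open>Minimizing over the free part of the past\<close>

definition hat_fibre :: "'s seq \<Rightarrow> 's seq set" where
  "hat_fibre w = {y \<in> pasts_of M (shiftn (Suc 0) w). y 0 = w 0}"

text \<open>\<open>hat_fibre w\<close> is the fibre of \<open>tau\<close> over \<open>w\<close>: the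
  first symbol of the past is \<open>w 0\<close>, the rest is free. So \<open>B w\<close> is the
  least price of a step between \<open>shiftn (Suc 0) w\<close> and \<open>w\<close>.\<close>

definition B :: "'s seq \<Rightarrow> real" where
  "B w = (INF y\<in>hat_fibre w. A (y, shiftn (Suc 0) w))"

lemma hat_fibre_eq: "w \<in> \<Sigma> \<Longrightarrow> hat_fibre w = {y \<in> past_space M. y 0 = w 0}"
  by (auto simp: hat_fibre_def pasts_of_def shiftn_def shift_space_def)

lemma hat_fibre_hat: "w \<in> \<Sigma> \<Longrightarrow> y \<in> hat_fibre w \<Longrightarrow> (y, shiftn (Suc 0) w) \<in> hat_space M"
  by (simp add: hat_fibre_def hat_space_def shiftn_in)

lemma tau_in: "(y, x) \<in> hat_space M \<Longrightarrow> tau y x \<in> \<Sigma>"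
  by (auto simp: hat_space_def pasts_of_def shift_space_def tau_def split: nat.split)

lemma hat_fibre_tau: "(y, x) \<in> hat_space M \<Longrightarrow> y \<in> hat_fibre (tau y x)"
  by (auto simp: hat_space_def hat_fibre_def) (simp add: tau_def)

lemma hat_space_nonempty: "hat_space M \<noteq> {}"
  using shift_space_nonempty past_exists hat_fibre_hat hat_fibre_eq by fastforce

lemma A_bounded: "\<exists>a. \<forall>z\<in>hat_space M. \<bar>A z\<bar> \<le> a"
proof -
  obtain z0 where "z0 \<in> hat_space M" using hat_space_nonempty by blast
  then have "\<forall>z\<in>hat_space M. \<bar>A z\<bar> \<le> \<bar>A z0\<bar> + K" using holder[of _ z0 0] by fastforce
  then show ?thesis by blast
qed

definition bd :: real where "bd = (SOME a. \<forall>z\<in>hat_space M. \<bar>A z\<bar> \<le> a)"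

lemma A_le_bd: "z \<in> hat_space M \<Longrightarrow> \<bar>A z\<bar> \<le> bd"
  using someI_ex[OF A_bounded] unfolding bd_def by blast

lemma bd_nonneg: "0 \<le> bd"
  using hat_space_nonempty A_le_bd by (metis abs_ge_zero all_not_in_conv order_trans)

lemma bdd_below_fibre: "w \<in> \<Sigma> \<Longrightarrow> bdd_below ((\<lambda>y. A (y, shiftn (Suc 0) w)) ` hat_fibre w)"
  using A_le_bd hat_fibre_hat by (intro bdd_belowI2[of _ "- bd"]) (smt (verit))

lemma B_le: "w \<in> \<Sigma> \<Longrightarrow> y \<in> hat_fibre w \<Longrightarrow> B w \<le> A (y, shiftn (Suc 0) w)"
  unfolding B_def using bdd_below_fibre by (intro cINF_lower)

lemma B_le_A: "(y, x) \<in> hat_space M \<Longrightarrow> B (tau y x) \<le> A (y, x)"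
  using B_le[OF tau_in hat_fibre_tau] by simp

lemma theta_small: "0 < e \<Longrightarrow> \<exists>n. C * \<theta> ^ n < e"
proof -
  assume "0 < e"
  have "(\<lambda>n. C * \<theta> ^ n) \<longlonglongrightarrow> C * 0"
    using \<theta> by (intro tendsto_mult_left LIMSEQ_realpow_zero) auto
  then have "\<forall>\<^sub>F n in sequentially. C * \<theta> ^ n < e"
    using \<open>0 < e\<close> by (intro order_tendstoD) auto
  then show ?thesis by (meson eventually_happens' sequentially_bot)
qed

text \<open>Compactness of the fibre and continuity of \<open>A\<close>: a cluster point of almost
  optimal pasts is optimal.\<close>

lemma B_attained:
  assumes "w \<in> \<Sigma>"
  shows "\<exists>y\<in>hat_fibre w. A (y, shiftn (Suc 0) w) = B w"
proof -
  let ?x = "shiftn (Suc 0) w"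
  have ne: "hat_fibre w \<noteq> {}" using past_exists hat_fibre_eq[OF assms] by auto
  have "\<exists>y\<in>hat_fibre w. A (y, ?x) < B w + inverse (real (Suc k))" for k
  proof -
    have "B w < B w + inverse (real (Suc k))" by simp
    then show ?thesis
      using cINF_less_iff[OF ne bdd_below_fibre[OF assms]] unfolding B_def by blast
  qed
  then obtain f where f: "\<And>k. f k \<in> hat_fibre w" "\<And>k. A (f k, ?x) < B w + inverse (real (Suc k))"
    by metis
  obtain y where y: "\<And>n. infinite {k. agree n (f k) y}" using cluster_point by blast
  have yn: "\<exists>k\<ge>N. agree n (f k) y" for n N
    using y[of n] by (meson infinite_nat_iff_unbounded_le mem_Collect_eq)
  have "y \<in> past_space M"
    unfolding past_space_def
  proof safe
    fix j
    obtain k where "agree (Suc (Suc j)) (f k) y" using yn by blast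
    moreover have "f k \<in> past_space M" using f(1) hat_fibre_eq[OF assms] by blast
    ultimately show "edge (y (Suc j)) (y j)"
      unfolding agree_def past_space_def by (metis (mono_tags, lifting) lessI less_SucI mem_Collect_eq)
  qed
  moreover obtain k where "agree 1 (f k) y" using yn by blast
  then have "y 0 = w 0" using f(1) hat_fibre_eq[OF assms] by (auto simp: agree_def)
  ultimately have yf: "y \<in> hat_fibre w" using hat_fibre_eq[OF assms] by blast
  have "A (y, ?x) \<le> B w + e" if "0 < e" for e
  proof -
    obtain n where n: "K * \<theta> ^ n < e / 2" using theta_small[of "e/2"] \<open>0 < e\<close> by auto
    obtain N where N: "inverse (real (Suc N)) < e / 2"
      using reals_Archimedean[of "e/2"] \<open>0 < e\<close> by auto
    obtain k where k: "k \<ge> N" "agree n (f k) y" using yn by blast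
    have "inverse (real (Suc k)) \<le> inverse (real (Suc N))" using k(1) by simp
    moreover have "\<bar>A (f k, ?x) - A (y, ?x)\<bar> \<le> K * \<theta> ^ n"
      using k f(1) yf assms by (intro holder) (auto simp: hat_fibre_hat)
    ultimately show ?thesis using f(2)[of k] n N by linarith
  qed
  then have "A (y, ?x) \<le> B w" by (rule field_le_epsilon)
  then show ?thesis using B_le[OF assms yf] yf by force
qed

text \<open>The fibre depends on \<open>w 0\<close> only, so a past optimal for \<open>w'\<close>
  competes for \<open>w\<close>. The first symbol of the agreement is spent on this, which leaves
  \<open>n\<close> for the tails.\<close>

lemma B_holder:
  assumes "w \<in> \<Sigma>" "w' \<in> \<Sigma>" "agree (Suc n) w w'"
  shows "B w \<le> B w' + K * \<theta> ^ n"
proof -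
  obtain y where y: "y \<in> hat_fibre w'" "A (y, shiftn (Suc 0) w') = B w'"
    using B_attained assms by blast
  have yw: "y \<in> hat_fibre w" using y(1) assms by (auto simp: hat_fibre_eq agree_def)
  have "\<bar>A (y, shiftn (Suc 0) w) - A (y, shiftn (Suc 0) w')\<bar> \<le> K * \<theta> ^ n"
    using assms y(1) yw agree_shiftn[of n "Suc 0"] by (intro holder) (auto simp: hat_fibre_hat)
  then show ?thesis using B_le[OF assms(1) yw] y(2) by linarith
qed

lemma B_le_bd: "w \<in> \<Sigma> \<Longrightarrow> \<bar>B w\<bar> \<le> bd"
  using B_attained A_le_bd hat_fibre_hat by metis

section \<open>Birkhoff sums and bounded distortion\<close>

definition S :: "real \<Rightarrow> nat \<Rightarrow> 's seq \<Rightarrow> real" where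
  "S c k w = (\<Sum>i<k. B (shiftn i w) - c)"

lemma S_0 [simp]: "S c 0 w = 0"
  by (simp add: S_def)

lemma S_1: "S c (Suc 0) w = B w - c"
  by (simp add: S_def)

lemma S_add: "S c (k + l) w = S c k w + S c l (shiftn k w)"
proof -
  have "(\<Sum>i<k + l. B (shiftn i w) - c) = (\<Sum>i<k. B (shiftn i w) - c) + (\<Sum>i=k..<k + l. B (shiftn i w) - c)"
    by (simp add: lessThan_atLeast0 sum.atLeastLessThan_concat)
  also have "(\<Sum>i=k..<k + l. B (shiftn i w) - c) = (\<Sum>i<l. B (shiftn (i + k) w) - c)"
    using sum.shift_bounds_nat_ivl[of "\<lambda>i. B (shiftn i w) - c" 0 k l]
    by (simp add: lessThan_atLeast0 add.commute)
  finally show ?thesis by (simp add: S_def)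
qed

lemma S_le_bd: "w \<in> \<Sigma> \<Longrightarrow> \<bar>S c k w\<bar> \<le> real k * (bd + \<bar>c\<bar>)"
proof -
  assume w: "w \<in> \<Sigma>"
  have "\<bar>B (shiftn i w) - c\<bar> \<le> bd + \<bar>c\<bar>" for i using B_le_bd[OF shiftn_in[OF w, of i]] by linarith
  then have "\<bar>S c k w\<bar> \<le> (\<Sum>i<k. bd + \<bar>c\<bar>)"
    unfolding S_def by (intro order_trans[OF sum_abs] sum_mono)
  then show ?thesis by simp
qed

definition D :: real where "D = K / (1 - \<theta>)"

lemma D_nonneg: "0 \<le> D"
  using K \<theta> by (simp add: D_def)

text \<open>At time \<open>i\<close> the two orbits still share \<open>k + n - i\<close> symbols, so
  the errors form a geometric series with a bound independent of \<open>k\<close>. The constant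
  \<open>c\<close> is arbitrary because candidates other than \<open>m\<close> are tested
  later.\<close>

lemma S_distortion:
  assumes "w \<in> \<Sigma>" "w' \<in> \<Sigma>" "agree (k + n) w w'"
  shows "S c k w \<le> S c k w' + D * \<theta> ^ n"
proof -
  have "B (shiftn i w) \<le> B (shiftn i w') + K * \<theta> ^ n * \<theta> ^ (k - Suc i)" if "i < k" for i
  proof -
    have "Suc (n + (k - Suc i)) + i = k + n" using that by simp
    then have "agree (Suc (n + (k - Suc i))) (shiftn i w) (shiftn i w')"
      using assms(3) by (intro agree_shiftn) metis
    from B_holder[OF _ _ this] show ?thesis using assms shiftn_in by (simp add: power_add mult.assoc)
  qed
  then have "S c k w \<le> (\<Sum>i<k. B (shiftn i w') - c + K * \<theta> ^ n * \<theta> ^ (k - Suc i))"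
    unfolding S_def by (intro sum_mono) fastforce
  also have "\<dots> = S c k w' + K * \<theta> ^ n * (\<Sum>i<k. \<theta> ^ (k - Suc i))"
    by (simp add: S_def sum.distrib sum_distrib_left)
  also have "(\<Sum>i<k. \<theta> ^ (k - Suc i)) = (\<Sum>i<k. \<theta> ^ i)"
    by (rule sum.nat_diff_reindex)
  also have "\<dots> = (1 - \<theta> ^ k) / (1 - \<theta>)"
    using \<theta> by (simp add: sum_gp_strict)
  also have "K * \<theta> ^ n * ((1 - \<theta> ^ k) / (1 - \<theta>)) \<le> D * \<theta> ^ n"
    using K \<theta> by (simp add: D_def divide_right_mono mult_left_mono mult_left_le)
  finally show ?thesis by simp
qed

section \<open>The minimizing value\<close>

lemma A_measurable: "A \<in> borel_measurable (hat_borel M lam)"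
proof (rule borel_measurable_hat[OF lam])
  fix z and e :: real assume z: "z \<in> hat_space M" and "0 < e"
  then obtain n where "K * \<theta> ^ n < e" using theta_small by blast
  then show "\<exists>n. \<forall>z'\<in>hat_space M. agree n (fst z) (fst z') \<longrightarrow> agree n (snd z) (snd z') \<longrightarrow> \<bar>A z - A z'\<bar> < e"
    using holder[OF z] by (meson le_less_trans)
qed

lemma continuous_compose_measurable:
  assumes f: "continuous_on_shift M lam f"
    and T: "\<And>z. z \<in> hat_space M \<Longrightarrow> T z \<in> \<Sigma>"
      "\<And>n z z'. agree n (fst z) (fst z') \<Longrightarrow> agree n (snd z) (snd z') \<Longrightarrow> agree n (T z) (T z')"
  shows "(\<lambda>z. f (T z)) \<in> borel_measurable (hat_borel M lam)"
proof (rule borel_measurable_hat[OF lam])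
  fix z and e :: real assume z: "z \<in> hat_space M" and "0 < e"
  then obtain n where "\<forall>y\<in>\<Sigma>. agree n (T z) y \<longrightarrow> \<bar>f (T z) - f y\<bar> < e"
    using f T(1) unfolding continuous_on_shift_iff[OF lam] by blast
  then show "\<exists>n. \<forall>z'\<in>hat_space M. agree n (fst z) (fst z') \<longrightarrow> agree n (snd z) (snd z') \<longrightarrow> \<bar>f (T z) - f (T z')\<bar> < e"
    using T by blast
qed

lemma continuous_endpoints_measurable:
  assumes "continuous_on_shift M lam f"
  shows "(\<lambda>(y, x). f x) \<in> borel_measurable (hat_borel M lam)"
    and "(\<lambda>(y, x). f (tau y x)) \<in> borel_measurable (hat_borel M lam)"
proof -
  show "(\<lambda>(y, x). f x) \<in> borel_measurable (hat_borel M lam)"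
    unfolding split_beta
    by (rule continuous_compose_measurable[OF assms]) (auto simp: hat_space_def)
  show "(\<lambda>(y, x). f (tau y x)) \<in> borel_measurable (hat_borel M lam)"
    unfolding split_beta
    by (rule continuous_compose_measurable[OF assms]) (auto simp: tau_in agree_tau)
qed

lemma continuous_bounded:
  assumes "continuous_on_shift M lam f"
  shows "\<exists>b. \<forall>x\<in>\<Sigma>. \<bar>f x\<bar> \<le> b"
proof (rule ccontr)
  assume "\<nexists>b. \<forall>x\<in>\<Sigma>. \<bar>f x\<bar> \<le> b"
  then have "\<forall>k::nat. \<exists>x\<in>\<Sigma>. real k < \<bar>f x\<bar>" by (meson not_le)
  then obtain X where X: "\<And>k::nat. X k \<in> \<Sigma>" "\<And>k. real k < \<bar>f (X k)\<bar>" by metis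
  obtain p where p: "\<And>n. infinite {k. agree n (X k) p}" using cluster_point by blast
  have pk: "\<exists>k\<ge>N. agree n (X k) p" for n N
    using p[of n] by (meson infinite_nat_iff_unbounded_le mem_Collect_eq)
  have "p \<in> \<Sigma>" using pk X(1) by (intro closed_shift) blast
  then obtain n where n: "\<forall>y\<in>\<Sigma>. agree n p y \<longrightarrow> \<bar>f p - f y\<bar> < 1"
    using assms unfolding continuous_on_shift_iff[OF lam] using zero_less_one by blast
  obtain N where "\<bar>f p\<bar> + 1 \<le> real N" using real_arch_simple by blast
  moreover obtain k where "k \<ge> N" "agree n (X k) p" using pk by blast
  ultimately show False using X[of k] n agree_sym[of n "X k" p] by fastforce
qed

text \<open>Integrate the inequality: the left side becomes a difference of two integrals that agree
  for a holonomic measure.\<close>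

lemma holonomic_lower:
  assumes mu: "\<mu> \<in> holonomic_measures M lam"
    and u: "continuous_on_shift M lam u"
    and le: "\<And>y x. (y, x) \<in> hat_space M \<Longrightarrow> u x - u (tau y x) \<le> A (y, x) - c"
  shows "c \<le> (\<integral>z. A z \<partial>\<mu>)"
proof -
  interpret prob_space \<mu> using mu by (simp add: holonomic_measures_def)
  have sets: "sets \<mu> = sets (hat_borel M lam)" using mu by (simp add: holonomic_measures_def)
  then have space: "space \<mu> = hat_space M" using sets_eq_imp_space_eq space_hat_borel by blast
  obtain b where b: "\<And>x. x \<in> \<Sigma> \<Longrightarrow> \<bar>u x\<bar> \<le> b" using continuous_bounded[OF u] by blast
  have meas: "g \<in> borel_measurable (hat_borel M lam) \<Longrightarrow> g \<in> borel_measurable \<mu>" for g :: "_ \<Rightarrow> real"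
    using measurable_cong_sets[OF sets refl] by blast
  have iA: "integrable \<mu> A"
    using A_le_bd space by (intro integrable_const_bound[OF AE_I2 meas[OF A_measurable]]) fastforce
  have bnd: "\<bar>u x\<bar> \<le> b" "\<bar>u (tau y x)\<bar> \<le> b" if "(y, x) \<in> space \<mu>" for x y
  proof -
    have hat: "(y, x) \<in> hat_space M" using that space by simp
    show "\<bar>u (tau y x)\<bar> \<le> b" by (rule b[OF tau_in[OF hat]])
    from hat have "x \<in> \<Sigma>" unfolding hat_space_def by blast
    then show "\<bar>u x\<bar> \<le> b" by (rule b)
  qed
  have i1: "integrable \<mu> (\<lambda>(y, x). u x)"
    using bnd by (intro integrable_const_bound[OF AE_I2 meas[OF continuous_endpoints_measurable(1)[OF u]]]) fastforce
  have i2: "integrable \<mu> (\<lambda>(y, x). u (tau y x))"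
    using bnd by (intro integrable_const_bound[OF AE_I2 meas[OF continuous_endpoints_measurable(2)[OF u]]]) fastforce
  have "(\<integral>(y, x). u (tau y x) \<partial>\<mu>) = (\<integral>(y, x). u x \<partial>\<mu>)"
    using mu u unfolding holonomic_measures_def by blast
  then have "0 = (\<integral>z. (case z of (y, x) \<Rightarrow> u x) - (case z of (y, x) \<Rightarrow> u (tau y x)) \<partial>\<mu>)"
    using Bochner_Integration.integral_diff[OF i1 i2] by simp
  also have "\<dots> \<le> (\<integral>z. A z - c \<partial>\<mu>)"
  proof (rule integral_mono)
    fix z assume "z \<in> space \<mu>"
    then show "(case z of (y, x) \<Rightarrow> u x) - (case z of (y, x) \<Rightarrow> u (tau y x)) \<le> A z - c"
      using le[of "fst z" "snd z"] space by (simp add: split_beta)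
  qed (rule Bochner_Integration.integrable_diff[OF i1 i2], simp add: iA)
  also have "\<dots> = (\<integral>z. A z \<partial>\<mu>) - c"
    using iA by (simp add: prob_space)
  finally show ?thesis by simp
qed

lemma continuous_const: "continuous_on_shift M lam (\<lambda>_. c)"
  by (simp add: continuous_on_shift_def)

text \<open>The measure is uniform on \<open>N\<close> pairs, each consisting of an optimal past for
  one step of the orbit and the point that follows. \<open>tau\<close> moves the second components
  back by one place in the cycle, hence holonomy.\<close>

lemma periodic_measure:
  assumes p: "p \<in> \<Sigma>" and N: "0 < N" and per: "shiftn N p = p"
  shows "\<exists>\<mu>\<in>holonomic_measures M lam. (\<integral>z. A z \<partial>\<mu>) = (\<Sum>i<N. B (shiftn i p)) / N"
proof -
  have "\<exists>y\<in>hat_fibre (shiftn i p). A (y, shiftn (Suc i) p) = B (shiftn i p)" for i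
    using B_attained[OF shiftn_in[OF p, of i]] by simp
  then obtain Y where Y: "\<And>i. Y i \<in> hat_fibre (shiftn i p)" "\<And>i. A (Y i, shiftn (Suc i) p) = B (shiftn i p)"
    by metis
  define Z where "Z = (\<lambda>i. (Y i, shiftn (Suc i) p))"
  have Z: "Z i \<in> hat_space M" for i
    using hat_fibre_hat[OF shiftn_in[OF p, of i] Y(1)] by (simp add: Z_def)
  have tauZ: "tau (Y i) (shiftn (Suc i) p) = shiftn i p" for i
    using tau_shiftn[of "Y i" "shiftn i p"] Y(1)[of i] by (simp add: hat_fibre_def)
  define \<mu> where "\<mu> = distr (uniform_count_measure {..<N}) (hat_borel M lam) Z"
  have Zm: "Z \<in> measurable (uniform_count_measure {..<N}) (hat_borel M lam)"
    using Z by (auto simp: measurable_def sets_uniform_count_measure space_uniform_count_measure)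
  have int: "integral\<^sup>L \<mu> g = (\<Sum>i<N. g (Z i)) / N"
    if "g \<in> borel_measurable (hat_borel M lam)" for g :: "_ \<Rightarrow> real"
    unfolding \<mu>_def integral_distr[OF Zm that] by (simp add: integral_uniform_count_measure)
  have "\<mu> \<in> holonomic_measures M lam"
    unfolding holonomic_measures_def
  proof (intro CollectI conjI allI impI)
    have "prob_space (uniform_count_measure {..<N})"
      using N by (intro prob_space_uniform_count_measure) auto
    then show "prob_space \<mu>" unfolding \<mu>_def using Zm by (rule prob_space.prob_space_distr)
    show "sets \<mu> = sets (hat_borel M lam)" by (simp add: \<mu>_def)
    fix f assume f: "continuous_on_shift M lam f"
    have "(\<Sum>i<N. f (shiftn i p)) = (\<Sum>i<N. f (shiftn (Suc i) p))"
      using sum.lessThan_Suc_shift[of "\<lambda>i. f (shiftn i p)" N] sum.lessThan_Suc[of "\<lambda>i. f (shiftn i p)" N] per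
      by simp
    then show "(\<integral>(y, x). f (tau y x) \<partial>\<mu>) = (\<integral>(y, x). f x \<partial>\<mu>)"
      using continuous_endpoints_measurable[OF f] by (simp add: int Z_def tauZ)
  qed
  moreover have "integral\<^sup>L \<mu> A = (\<Sum>i<N. B (shiftn i p)) / N"
    using A_measurable Y(2) by (simp add: int Z_def)
  ultimately show ?thesis by blast
qed

lemma integral_ge_bd: "\<mu> \<in> holonomic_measures M lam \<Longrightarrow> - bd \<le> (\<integral>z. A z \<partial>\<mu>)"
  using A_le_bd by (intro holonomic_lower[OF _ continuous_const[of 0]]) fastforce+

lemma m_le: "\<mu> \<in> holonomic_measures M lam \<Longrightarrow> m \<le> (\<integral>z. A z \<partial>\<mu>)"
  unfolding min_value_def using integral_ge_bd by (intro cINF_lower bdd_belowI2[of _ "- bd"])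

section \<open>Lower bound for Birkhoff sums\<close>

lemma S_periodic_nonneg:
  assumes "p \<in> \<Sigma>" "shiftn N p = p"
  shows "0 \<le> S m N p"
proof (cases "N = 0")
  case False
  then have "m \<le> (\<Sum>i<N. B (shiftn i p)) / N"
    using periodic_measure[OF assms(1) _ assms(2)] m_le by force
  then show ?thesis using False by (simp add: S_def sum_subtractf field_simps)
qed simp

text \<open>The first \<open>k\<close> symbols of \<open>w\<close> are followed by a word leading
  from \<open>w k\<close> back to \<open>w 0\<close>, and the loop is repeated. \<open>k < N\<close>
  since the closing word has at least one edge.\<close>

lemma periodic_exists:
  assumes "w \<in> \<Sigma>"
  obtains N p where "p \<in> \<Sigma>" "shiftn N p = p" "k < N" "N \<le> k + gap" "agree k w p"
proof -
  obtain n q where q: "1 \<le> n" "n \<le> gap" "q 0 = w k" "q n = w 0" "\<And>t. t < n \<Longrightarrow> edge (q t) (q (Suc t))"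
    by (rule connect) blast
  let ?r = "glue k w q"
  define p where "p = (\<lambda>j. ?r (j mod (k + n)))"
  have "p \<in> \<Sigma>"
    unfolding p_def
  proof (rule periodic_in)
    show "0 < k + n" using q by simp
    show "?r (k + n) = ?r 0" using q by (auto simp: glue_def)
    fix t assume t: "t < k + n"
    consider "Suc t < k" | "Suc t = k" | "k \<le> t" by linarith
    then show "edge (?r t) (?r (Suc t))"
      using shift_spaceD[OF assms, of t] q(3) q(5)[of "t - k"] t
      by cases (auto simp: glue_def Suc_diff_le)
  qed
  moreover have "shiftn (k + n) p = p" by (simp add: shiftn_def p_def)
  moreover have "agree k w p" using q(1) by (simp add: agree_def p_def glue_def)
  ultimately show ?thesis using that[of p "k + n"] q by simp
qed

text \<open>\<open>D\<close> pays for passing between a point and the periodic point that shadows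
  it, the other term for the closing word.\<close>

definition lo :: real where "lo = D + real gap * (bd + \<bar>m\<bar>)"

lemma gap_bound: "w \<in> \<Sigma> \<Longrightarrow> n \<le> gap \<Longrightarrow> \<bar>S m n w\<bar> \<le> real gap * (bd + \<bar>m\<bar>)"
  using S_le_bd[of w m n] bd_nonneg
  by (smt (verit, ccfv_SIG) mult_right_mono of_nat_le_iff)

lemma S_ge:
  assumes w: "w \<in> \<Sigma>"
  shows "- lo \<le> S m k w"
proof -
  obtain N p where p: "p \<in> \<Sigma>" "shiftn N p = p" "k < N" "N \<le> k + gap" "agree k w p"
    using periodic_exists[OF w] by metis
  have "0 \<le> S m k p + S m (N - k) (shiftn k p)"
    using S_periodic_nonneg[OF p(1,2)] S_add[of m k "N - k" p] p(3) by simp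
  moreover have "\<bar>S m (N - k) (shiftn k p)\<bar> \<le> real gap * (bd + \<bar>m\<bar>)"
    using p by (intro gap_bound shiftn_in) auto
  moreover have "S m k p \<le> S m k w + D"
    using S_distortion[OF p(1) w, of k 0 m] p(5) agree_sym by auto
  ultimately show ?thesis unfolding lo_def by linarith
qed

text \<open>Any constant for which the Birkhoff sums stay bounded below admits a continuous sub-action
  (the infimum of the sums over all backward orbits), hence lies below every holonomic mean.\<close>

lemma bounded_below_imp_sub_action:
  assumes bb: "\<And>k w. w \<in> \<Sigma> \<Longrightarrow> b \<le> S c k w"
  obtains u where "continuous_on_shift M lam u" "\<And>w. w \<in> \<Sigma> \<Longrightarrow> u (shiftn (Suc 0) w) - u w \<le> B w - c"
proof -
  \<comment> \<open>Length \<open>k = 0\<close> contributes the value 0, so \<open>V x\<close> is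
    non-empty for \<open>x\<close> in the shift space.\<close>
  define V where "V x = {S c k w | k w. w \<in> \<Sigma> \<and> shiftn k w = x}" for x
  define u where "u x = Inf (V x)" for x
  have V: "S c k w \<in> V (shiftn k w)" if "w \<in> \<Sigma>" for k w using that by (auto simp: V_def)
  have bdd: "bdd_below (V x)" for x using bb by (auto simp: V_def bdd_below_def)
  have u_le: "u (shiftn k w) \<le> S c k w" if "w \<in> \<Sigma>" for k w
    unfolding u_def using V bdd that by (intro cInf_lower)
  have ge_u: "t \<le> u x" if "x \<in> \<Sigma>" "\<And>k w. w \<in> \<Sigma> \<Longrightarrow> shiftn k w = x \<Longrightarrow> t \<le> S c k w" for t x
    unfolding u_def using V[of x 0] that by (intro cInf_greatest) (auto simp: V_def)
  \<comment> \<open>Agreement in at least one symbol keeps the word in front of \<open>x\<close>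
    admissible in front of \<open>x'\<close>.\<close>
  have dist: "u x' - D * \<theta> ^ n \<le> u x" if x: "x \<in> \<Sigma>" "x' \<in> \<Sigma>" "agree n x x'" "0 < n" for x x' n
  proof (rule ge_u[OF x(1)])
    fix k w assume w: "w \<in> \<Sigma>" "shiftn k w = x"
    let ?w = "glue k w x'"
    have w': "?w \<in> \<Sigma>" using x w by (intro glue_in_agree) auto
    have "u x' \<le> S c k ?w" using u_le[OF w', of k] by simp
    also have "\<dots> \<le> S c k w + D * \<theta> ^ n" using w x w' by (intro S_distortion agree_glue) auto
    finally show "u x' - D * \<theta> ^ n \<le> S c k w" by simp
  qed
  have "continuous_on_shift M lam u"
    unfolding continuous_on_shift_iff[OF lam]
  proof (intro ballI allI impI)
    fix x and e :: real assume x: "x \<in> \<Sigma>" and "0 < e"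
    then obtain n where "D * \<theta> ^ n < e" using theta_small by blast
    moreover have "D * \<theta> ^ Suc n \<le> D * \<theta> ^ n" using \<theta> D_nonneg by (intro mult_left_mono) auto
    ultimately have n: "D * \<theta> ^ Suc n < e" by linarith
    have "\<bar>u x - u y\<bar> < e" if y: "y \<in> \<Sigma>" "agree (Suc n) x y" for y
      using dist[OF x y(1) y(2)] dist[OF y(1) x agree_sym[OF y(2)]] n by auto
    then show "\<exists>n. \<forall>y\<in>\<Sigma>. agree n x y \<longrightarrow> \<bar>u x - u y\<bar> < e" by blast
  qed
  moreover have "u (shiftn (Suc 0) w) - u w \<le> B w - c" if w: "w \<in> \<Sigma>" for w
  proof -
    have "u (shiftn (Suc 0) w) - (B w - c) \<le> u w"
    proof (rule ge_u[OF w])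
      fix k v assume v: "v \<in> \<Sigma>" "shiftn k v = w"
      then have "shiftn (Suc 0) w = shiftn (k + Suc 0) v" by auto
      then have "u (shiftn (Suc 0) w) \<le> S c (k + Suc 0) v" using u_le v by metis
      then show "u (shiftn (Suc 0) w) - (B w - c) \<le> S c k v"
        unfolding S_add using v by (simp add: S_1)
    qed
    then show ?thesis by simp
  qed
  ultimately show ?thesis using that by blast
qed

lemma bounded_below_imp_le:
  assumes "\<And>k w. w \<in> \<Sigma> \<Longrightarrow> b \<le> S c k w"
  shows "c \<le> m"
proof -
  obtain u where u: "continuous_on_shift M lam u"
      "\<And>w. w \<in> \<Sigma> \<Longrightarrow> u (shiftn (Suc 0) w) - u w \<le> B w - c"
    using bounded_below_imp_sub_action assms by metis
  have *: "u x - u (tau y x) \<le> A (y, x) - c" if "(y, x) \<in> hat_space M" for y x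
    using u(2)[OF tau_in[OF that]] B_le_A[OF that] by simp
  \<comment> \<open>The infimum defining \<open>m\<close> has to be over a non-empty set; closing up
    a word of length 0 already yields a periodic point.\<close>
  obtain w N p where "p \<in> \<Sigma>" "shiftn N p = p" "0 < N"
    using periodic_exists[where k = 0] shift_space_nonempty by (metis all_not_in_conv)
  then have "holonomic_measures M lam \<noteq> {}" using periodic_measure by blast
  then show ?thesis
    unfolding min_value_def using holonomic_lower[OF _ u(1) *] by (intro cINF_greatest)
qed

text \<open>If all sums of length \<open>k\<close> were at least \<open>\<eta>\<close>, the constant
  could be raised to \<open>m + \<eta> / k\<close> with the sums still bounded below, against
  \<open>bounded_below_imp_le\<close>.\<close>

lemma short_sums_nonpos:
  assumes "0 < k" "0 < \<eta>"
  shows "\<exists>w\<in>\<Sigma>. S m k w < \<eta>"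
proof (rule ccontr)
  assume "\<not> ?thesis"
  then have ge: "\<eta> \<le> S m k w" if "w \<in> \<Sigma>" for w using that by (meson not_le)
  define c where "c = m + \<eta> / k"
  have Sk: "0 \<le> S c k w" if "w \<in> \<Sigma>" for w
  proof -
    have "S c k w = S m k w - \<eta>"
      using assms by (simp add: S_def c_def sum_subtractf distrib_left)
    then show ?thesis using ge[OF that] by simp
  qed
  \<comment> \<open>Cut the orbit into blocks of length \<open>k\<close>, each with a non-negative
    sum; the incomplete last block has fewer than \<open>k\<close> terms and gets the trivial
    bound.\<close>
  have "- (real k * (bd + \<bar>c\<bar>)) \<le> S c n w" if "w \<in> \<Sigma>" for n w
    using that
  proof (induction n arbitrary: w rule: less_induct)
    case (less n)
    show ?case
    proof (cases "n < k")
      case True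
      then have "real n * (bd + \<bar>c\<bar>) \<le> real k * (bd + \<bar>c\<bar>)"
        using bd_nonneg by (intro mult_right_mono) auto
      then show ?thesis using S_le_bd[OF less.prems, of c n] by linarith
    next
      case False
      then have "S c n w = S c k w + S c (n - k) (shiftn k w)" using S_add[of c k "n - k" w] by simp
      then show ?thesis
        using Sk[OF less.prems] less.IH[of "n - k" "shiftn k w"] False assms(1) shiftn_in[OF less.prems]
        by fastforce
    qed
  qed
  then have "c \<le> m" by (rule bounded_below_imp_le)
  moreover have "0 < \<eta> / k" using assms by simp
  ultimately show False by (simp add: c_def)
qed

section \<open>Sub-actions in terms of \<open>B\<close>\<close>

lemma sub_action_iff:
  "sub_action M lam A u \<longleftrightarrow> continuous_on_shift M lam u \<and> (\<forall>w\<in>\<Sigma>. u (shiftn (Suc 0) w) \<le> u w + B w - m)"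
proof -
  have "(\<forall>(y, x)\<in>hat_space M. u x - u (tau y x) \<le> A (y, x) - m) \<longleftrightarrow>
    (\<forall>w\<in>\<Sigma>. u (shiftn (Suc 0) w) \<le> u w + B w - m)" (is "?L \<longleftrightarrow> ?R")
  proof
    assume L: ?L
    show ?R
    proof
      fix w assume w: "w \<in> \<Sigma>"
      obtain y where y: "y \<in> hat_fibre w" "A (y, shiftn (Suc 0) w) = B w" using B_attained[OF w] by blast
      have "tau y (shiftn (Suc 0) w) = w" using y(1) tau_shiftn by (auto simp: hat_fibre_def)
      then show "u (shiftn (Suc 0) w) \<le> u w + B w - m" using L hat_fibre_hat[OF w y(1)] y(2) by fastforce
    qed
  next
    assume R: ?R
    have "u x - u (tau y x) \<le> A (y, x) - m" if yx: "(y, x) \<in> hat_space M" for y x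
      using bspec[OF R tau_in[OF yx]] B_le_A[OF yx] by simp
    then show ?L by blast
  qed
  then show ?thesis by (simp add: sub_action_def)
qed

text \<open>The minimum over pasts \<open>y\<close> of \<open>x\<close> splits into the choice of
  the first symbol, that is of a preimage \<open>w = tau y x\<close>, and a minimization over the
  rest, which gives \<open>B w\<close>.\<close>

lemma calibrated_iff:
  "calibrated_sub_action M lam A u \<longleftrightarrow> sub_action M lam A u \<and>
    (\<forall>x\<in>\<Sigma>. \<exists>w\<in>\<Sigma>. shiftn (Suc 0) w = x \<and> u x = u w + B w - m)"
proof -
  have "is_minimum (u x) ((\<lambda>y. u (tau y x) + A (y, x) - m) ` pasts_of M x) \<longleftrightarrow>
      (\<exists>w\<in>\<Sigma>. shiftn (Suc 0) w = x \<and> u x = u w + B w - m)" (is "?L \<longleftrightarrow> ?R")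
    if x: "x \<in> \<Sigma>" and sub: "sub_action M lam A u" for x
  proof
    have hat: "y \<in> pasts_of M x \<longleftrightarrow> (y, x) \<in> hat_space M" for y using x by (simp add: hat_space_def)
    assume ?L
    then obtain y where y: "(y, x) \<in> hat_space M" "u x = u (tau y x) + A (y, x) - m"
      using hat by (auto simp: is_minimum_def)
    have "u x \<le> u (tau y x) + B (tau y x) - m"
      using sub tau_in[OF y(1)] unfolding sub_action_iff by (metis shiftn_tau)
    then show ?R using y B_le_A[OF y(1)] tau_in[OF y(1)] by (intro bexI[of _ "tau y x"]) auto
  next
    assume ?R
    then obtain w where w: "w \<in> \<Sigma>" "shiftn (Suc 0) w = x" "u x = u w + B w - m" by blast
    obtain y where y: "y \<in> hat_fibre w" "A (y, x) = B w" using B_attained[OF w(1)] w(2) by blast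
    have "tau y x = w" using y(1) w(2) tau_shiftn by (auto simp: hat_fibre_def)
    moreover have "y \<in> pasts_of M x" using y(1) w(2) by (simp add: hat_fibre_def)
    moreover have "u x \<le> u (tau y x) + A (y, x) - m" if "y \<in> pasts_of M x" for y
      using sub x that by (fastforce simp: sub_action_def hat_space_def)
    ultimately show ?L using w(3) y(2) unfolding is_minimum_def by force
  qed
  then show ?thesis unfolding calibrated_sub_action_def by blast
qed

section \<open>Minimal cost of long backward orbits\<close>

text \<open>\<open>cost P x t\<close> says that the liminf of the sums over orbits of length \<open>k\<close> that end in \<open>x\<close> and whose
  starting point satisfies \<open>P\<close> in the limit is at most \<open>t\<close>. For \<open>P n w\<close> being agreement of \<open>w\<close>
  with a point \<open>p\<close> up to \<open>n\<close> this describes the Peierls barrier from \<open>p\<close>; the trivial \<open>P\<close>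
  gives the existence of some calibrated sub-action.\<close>

definition cost :: "(nat \<Rightarrow> 's seq \<Rightarrow> bool) \<Rightarrow> 's seq \<Rightarrow> real \<Rightarrow> bool" where
  "cost P x t \<longleftrightarrow> (\<forall>n. \<forall>e>0. \<exists>k\<ge>n. \<exists>w\<in>\<Sigma>. P n w \<and> shiftn k w = x \<and> S m k w < t + e)"

text \<open>The first clause lets \<open>P n\<close> survive a change of the tail after
  \<open>n\<close> symbols, the second allows \<open>n\<close> to be enlarged in
  constructions.\<close>

definition prefix_local :: "(nat \<Rightarrow> 's seq \<Rightarrow> bool) \<Rightarrow> bool" where
  "prefix_local P \<longleftrightarrow> (\<forall>n w w'. agree n w w' \<longrightarrow> P n w \<longrightarrow> P n w') \<and> (\<forall>n k w. n \<le> k \<longrightarrow> P k w \<longrightarrow> P n w)"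

definition min_cost :: "(nat \<Rightarrow> 's seq \<Rightarrow> bool) \<Rightarrow> 's seq \<Rightarrow> real" where
  "min_cost P x = Inf {t. cost P x t}"

lemma prefix_local_True: "prefix_local (\<lambda>_ _. True)"
  by (simp add: prefix_local_def)

lemma prefix_local_agree: "prefix_local (\<lambda>n w. agree n w x)"
  unfolding prefix_local_def using agree_mono agree_trans agree_sym by blast

lemma costE:
  assumes "cost P x t" "0 < e"
  obtains k w where "n \<le> k" "w \<in> \<Sigma>" "P n w" "shiftn k w = x" "S m k w < t + e"
  using assms unfolding cost_def by meson

lemma cost_ge: "cost P x t \<Longrightarrow> - lo \<le> t"
proof (rule field_le_epsilon)
  fix e :: real assume "cost P x t" "0 < e"
  then obtain k w where "(0::nat) \<le> k" "w \<in> \<Sigma>" "S m k w < t + e" by (rule costE) blast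
  then show "- lo \<le> t + e" using S_ge[of w k] by linarith
qed

text \<open>The slack \<open>e\<close> in \<open>cost\<close> makes the admissible \<open>t\<close>
  a closed half-line, bounded below by \<open>cost_ge\<close>. The witness \<open>t0\<close>
  excludes the empty set, whose \<open>Inf\<close> carries no information.\<close>

lemma cost_iff:
  assumes "cost P x t0"
  shows "cost P x t \<longleftrightarrow> min_cost P x \<le> t"
proof
  have bdd: "bdd_below {t. cost P x t}" using cost_ge by (auto simp: bdd_below_def)
  show "cost P x t \<Longrightarrow> min_cost P x \<le> t"
    unfolding min_cost_def using bdd by (intro cInf_lower) auto
  assume le: "min_cost P x \<le> t"
  show "cost P x t"
    unfolding cost_def
  proof (intro allI impI)
    fix n and e :: real assume "0 < e"
    then have "Inf {t. cost P x t} < t + e / 2" using le by (simp add: min_cost_def)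
    then obtain s where s: "cost P x s" "s < t + e / 2"
      using cInf_less_iff[OF _ bdd] assms by blast
    obtain k w where "n \<le> k" "w \<in> \<Sigma>" "P n w" "shiftn k w = x" "S m k w < s + e / 2"
      using costE[OF s(1), of "e/2" n] \<open>0 < e\<close> by auto
    then show "\<exists>k\<ge>n. \<exists>w\<in>\<Sigma>. P n w \<and> shiftn k w = x \<and> S m k w < t + e"
      using s(2) by (intro exI[of _ k] conjI bexI[of _ w]) auto
  qed
qed

text \<open>Glue \<open>w\<close> in place of the endpoint \<open>x\<close> and run on for
  \<open>l\<close> steps. With \<open>l = 0\<close> this compares nearby endpoints; with
  \<open>n = 0\<close> and a connecting word it reaches every endpoint.\<close>

lemma cost_extend:
  assumes P: "prefix_local P" and c: "cost P x t" and w: "w \<in> \<Sigma>" "agree (Suc n) x w"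
  shows "cost P (shiftn l w) (t + D * \<theta> ^ Suc n + S m l w)"
  unfolding cost_def
proof (intro allI impI)
  fix N and e :: real assume "0 < e"
  obtain k v where v: "N \<le> k" "v \<in> \<Sigma>" "P N v" "shiftn k v = x" "S m k v < t + e"
    using costE[OF c \<open>0 < e\<close>, of N] by metis
  let ?v = "glue k v w"
  have in\<Sigma>: "?v \<in> \<Sigma>" using w v by (intro glue_in_agree[of _ _ "Suc n"]) auto
  have "S m k ?v \<le> S m k v + D * \<theta> ^ Suc n"
    using w v in\<Sigma> by (intro S_distortion agree_glue) auto
  then have "S m (k + l) ?v < t + D * \<theta> ^ Suc n + S m l w + e"
    using v(5) by (simp add: S_add)
  moreover have "agree N v ?v" using agree_mono[OF agree_glue_prefix v(1)] agree_sym by blast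
  then have "P N ?v" using P v(3) unfolding prefix_local_def by blast
  moreover have "shiftn (k + l) ?v = shiftn l w"
    by (metis add.commute shiftn_glue shiftn_shiftn)
  ultimately show "\<exists>k\<ge>N. \<exists>v\<in>\<Sigma>. P N v \<and> shiftn k v = shiftn l w \<and> S m k v < t + D * \<theta> ^ Suc n + S m l w + e"
    using v(1) in\<Sigma> by (intro exI[of _ "k + l"] conjI bexI[of _ ?v]) auto
qed

text \<open>Here \<open>w\<close> itself is continued, so nothing is glued and no distortion arises;
  this exactness gives the sub-action inequality.\<close>

lemma cost_step:
  assumes P: "prefix_local P" and c: "cost P w t" and w: "w \<in> \<Sigma>"
  shows "cost P (shiftn (Suc 0) w) (t + B w - m)"
  unfolding cost_def
proof (intro allI impI)
  fix N and e :: real assume "0 < e"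
  obtain k v where v: "N \<le> k" "v \<in> \<Sigma>" "P N v" "shiftn k v = w" "S m k v < t + e"
    using costE[OF c \<open>0 < e\<close>, of N] by metis
  have "S m (k + Suc 0) v < t + B w - m + e" unfolding S_add using v by (simp add: S_1)
  moreover have "shiftn (k + Suc 0) v = shiftn (Suc 0) w" using v(4) by auto
  ultimately show "\<exists>k\<ge>N. \<exists>v\<in>\<Sigma>. P N v \<and> shiftn k v = shiftn (Suc 0) w \<and> S m k v < t + B w - m + e"
    using v by (intro exI[of _ "k + Suc 0"] conjI bexI[of _ v]) auto
qed

lemma cost_finite:
  assumes P: "prefix_local P" and c: "cost P x t" and x: "x' \<in> \<Sigma>"
  shows "\<exists>t'. cost P x' t'"
proof -
  obtain n w where w: "w \<in> \<Sigma>" "w 0 = x 0" "shiftn n w = x'" using connect_to[OF x] by metis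
  have "agree (Suc 0) x w" using w(2) by (simp add: agree_def)
  then show ?thesis using cost_extend[OF P c w(1), of 0 n] w(3) by metis
qed

text \<open>Among the finitely many symbols that can precede \<open>x\<close>, one is used by almost optimal orbits of
  arbitrary length.\<close>

lemma cost_back:
  assumes P: "prefix_local P" and c: "cost P x t"
  shows "\<exists>w\<in>\<Sigma>. shiftn (Suc 0) w = x \<and> cost P w (t - (B w - m))"
proof -
  \<comment> \<open>Starting from \<open>Suc n\<close> makes \<open>k\<close> exceed
    \<open>n\<close>, so the orbit is still long enough after its last step is removed.\<close>
  have "\<exists>k v. n < k \<and> v \<in> \<Sigma> \<and> P n v \<and> shiftn k v = x \<and> S m k v < t + inverse (real (Suc n))" for n
  proof -
    obtain k v where "Suc n \<le> k" "v \<in> \<Sigma>" "P (Suc n) v" "shiftn k v = x" "S m k v < t + inverse (real (Suc n))"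
      using costE[OF c, of "inverse (real (Suc n))" "Suc n"] by auto
    then show ?thesis using P unfolding prefix_local_def by (metis Suc_le_eq le_add2 plus_1_eq_Suc)
  qed
  then obtain k v where v: "\<And>n. n < k n" "\<And>n. v n \<in> \<Sigma>" "\<And>n. P n (v n)" "\<And>n. shiftn (k n) (v n) = x"
      "\<And>n. S m (k n) (v n) < t + inverse (real (Suc n))"
    by metis
  \<comment> \<open>The symbol placed just before \<open>x\<close>. One value \<open>b\<close>
    occurs for infinitely many \<open>n\<close>, and for all of these the point before
    \<open>x\<close> is the same.\<close>
  define a where "a n = v n (k n - 1)" for n
  have "\<exists>b. infinite {n. a n = b}"
    using pigeonhole_infinite[of UNIV a] by auto
  then obtain b where b: "infinite {n. a n = b}" by blast
  define w where "w = case_nat b x"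
  have w: "shiftn (k n - 1) (v n) = w" if "a n = b" for n
  proof
    fix j
    show "shiftn (k n - 1) (v n) j = w j"
    proof (cases j)
      case 0
      then show ?thesis using that by (simp add: shiftn_def w_def a_def)
    next
      case (Suc i)
      have "v n (i + k n) = x i" using v(4)[of n] unfolding shiftn_def by metis
      then show ?thesis using Suc v(1)[of n] by (simp add: shiftn_def w_def)
    qed
  qed
  obtain n0 where "a n0 = b" using b not_finite_existsD by blast
  then have wS: "w \<in> \<Sigma>" using w v(2) shiftn_in by metis
  have "cost P w (t - (B w - m))"
    unfolding cost_def
  proof (intro allI impI)
    fix N and e :: real assume "0 < e"
    obtain q where q: "inverse (real (Suc q)) < e"
      using reals_Archimedean[of e] \<open>0 < e\<close> by auto
    obtain n where n: "max N q \<le> n" "a n = b"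
      using b unfolding infinite_nat_iff_unbounded_le by blast
    have "S m (k n - 1 + Suc 0) (v n) = S m (k n - 1) (v n) + (B w - m)"
      unfolding S_add w[OF n(2)] S_1 ..
    moreover have "k n - 1 + Suc 0 = k n" using v(1)[of n] by simp
    ultimately have "S m (k n) (v n) = S m (k n - 1) (v n) + (B w - m)" by metis
    moreover have "inverse (real (Suc n)) \<le> inverse (real (Suc q))" using n(1) by simp
    ultimately have "S m (k n - 1) (v n) < t - (B w - m) + e" using v(5)[of n] q by linarith
    moreover have "P N (v n)" using P v(3)[of n] n(1) unfolding prefix_local_def by auto
    moreover have "N \<le> k n - 1" using v(1)[of n] n(1) by linarith
    ultimately show "\<exists>k\<ge>N. \<exists>u\<in>\<Sigma>. P N u \<and> shiftn k u = w \<and> S m k u < t - (B w - m) + e"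
      using v(2) w[OF n(2)] by blast
  qed
  moreover have "shiftn (Suc 0) w = x" by (simp add: shiftn_def w_def)
  ultimately show ?thesis using wS by blast
qed

text \<open>\<open>cost_step\<close> gives the sub-action inequality, \<open>cost_back\<close> the
  reverse one at some preimage, \<open>cost_extend\<close> the modulus of continuity. One finite
  value is enough to start, by \<open>cost_finite\<close>.\<close>

lemma min_cost_calibrated:
  assumes P: "prefix_local P" and c: "cost P x0 t0"
  shows "calibrated_sub_action M lam A (min_cost P)"
proof -
  have iff: "cost P x t \<longleftrightarrow> min_cost P x \<le> t" if "x \<in> \<Sigma>" for x t
    using cost_finite[OF P c that] cost_iff by blast
  have dist: "min_cost P x' \<le> min_cost P x + D * \<theta> ^ Suc n"
    if "x \<in> \<Sigma>" "x' \<in> \<Sigma>" "agree (Suc n) x x'" for x x' n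
    using cost_extend[OF P _ that(2,3), of "min_cost P x" 0] iff that by simp
  have cont: "continuous_on_shift M lam (min_cost P)"
    unfolding continuous_on_shift_iff[OF lam]
  proof (intro ballI allI impI)
    fix x and e :: real assume x: "x \<in> \<Sigma>" and "0 < e"
    then obtain n where n: "D * \<theta> * \<theta> ^ n < e" using theta_small by blast
    have "\<bar>min_cost P x - min_cost P y\<bar> < e" if y: "y \<in> \<Sigma>" "agree (Suc n) x y" for y
      using dist[OF x y] dist[OF y(1) x agree_sym[OF y(2)]] n by (auto simp: mult.assoc)
    then show "\<exists>n. \<forall>y\<in>\<Sigma>. agree n x y \<longrightarrow> \<bar>min_cost P x - min_cost P y\<bar> < e" by blast
  qed
  have le: "min_cost P (shiftn (Suc 0) w) \<le> min_cost P w + B w - m" if "w \<in> \<Sigma>" for w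
    using cost_step[OF P _ that] iff[OF that] iff[OF shiftn_in[OF that]] by blast
  moreover have "\<exists>w\<in>\<Sigma>. shiftn (Suc 0) w = x \<and> min_cost P x = min_cost P w + B w - m" if x: "x \<in> \<Sigma>" for x
  proof -
    obtain w where w: "w \<in> \<Sigma>" "shiftn (Suc 0) w = x" "cost P w (min_cost P x - (B w - m))"
      using cost_back[OF P] iff[OF x] by blast
    then show ?thesis using le[OF w(1)] iff[OF w(1)] by (intro bexI[of _ w]) auto
  qed
  ultimately show ?thesis unfolding calibrated_iff sub_action_iff using cont by blast
qed

text \<open>Serves to show that the non-wandering set is non-empty, so that minima over its
  components make sense.\<close>

lemma calibrated_exists: "\<exists>u. calibrated_sub_action M lam A u"
proof -
  obtain x where x: "x \<in> \<Sigma>" using shift_space_nonempty by blast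
  \<comment> \<open>\<open>D\<close> bounds the distortion at the joint after an almost free word of
    length \<open>Suc n\<close>, the other term the word that leads on to \<open>x\<close>.\<close>
  have "cost (\<lambda>_ _. True) x (D + real gap * (bd + \<bar>m\<bar>))"
    unfolding cost_def
  proof (intro allI impI)
    fix n and e :: real assume "0 < e"
    then obtain w where w: "w \<in> \<Sigma>" "S m (Suc n) w < e" using short_sums_nonpos by blast
    obtain l q where q: "l \<le> gap" "q \<in> \<Sigma>" "q 0 = w (Suc n)" "shiftn l q = x"
      using connect_to[OF x] by metis
    let ?v = "glue (Suc n) w q"
    have "agree 1 (shiftn (Suc n) w) q" using q(3) by (simp add: agree_def shiftn_def)
    then have v: "?v \<in> \<Sigma>" using q w by (intro glue_in_agree) auto
    have "S m (Suc n) ?v \<le> S m (Suc n) w + D"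
      using S_distortion[OF v w(1), of "Suc n" 0 m] agree_glue_prefix[of "Suc n" w q] by simp
    moreover have "S m (Suc n + l) ?v = S m (Suc n) ?v + S m l q"
      by (simp only: S_add shiftn_glue)
    ultimately have "S m (Suc n + l) ?v < D + real gap * (bd + \<bar>m\<bar>) + e"
      using gap_bound[OF q(2,1)] w(2) by linarith
    moreover have "shiftn (Suc n + l) ?v = x" using q(4) by (metis add.commute shiftn_glue shiftn_shiftn)
    ultimately show "\<exists>k\<ge>n. \<exists>w\<in>\<Sigma>. True \<and> shiftn k w = x \<and> S m k w < D + real gap * (bd + \<bar>m\<bar>) + e"
      using v by (intro exI[of _ "Suc n + l"]) auto
  qed
  then show ?thesis using min_cost_calibrated prefix_local_True by blast
qed

section \<open>The Peierls barrier\<close>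

lemma path_of_orbit:
  assumes w: "w \<in> \<Sigma>"
  shows "\<exists>z. is_path M k z \<and> snd (z 0) = w \<and> snd (z k) = shiftn k w \<and> action M lam A k z = S m k w"
proof -
  \<comment> \<open>The action starts at index 1, so the past of \<open>z 0\<close> is free; it only
    has to be admissible.\<close>
  obtain y0 where y0: "y0 \<in> pasts_of M w"
    using preimage_exists[OF w] B_attained unfolding hat_fibre_def by blast
  have "\<exists>y\<in>hat_fibre (shiftn i w). A (y, shiftn (Suc i) w) = B (shiftn i w)" for i
    using B_attained[OF shiftn_in[OF w, of i]] by simp
  then obtain Y where Y: "\<And>i. Y i \<in> hat_fibre (shiftn i w)" "\<And>i. A (Y i, shiftn (Suc i) w) = B (shiftn i w)"
    by metis
  define z where "z = (\<lambda>i. (case_nat y0 Y i, shiftn i w))"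
  have tauz: "tau (Y i) (shiftn (Suc i) w) = shiftn i w" for i
    using tau_shiftn[of "Y i" "shiftn i w"] Y(1)[of i] by (simp add: hat_fibre_def)
  have "z i \<in> hat_space M" for i
  proof (cases i)
    case 0
    then show ?thesis using y0 w by (simp add: z_def hat_space_def)
  next
    case (Suc j)
    then show ?thesis using hat_fibre_hat[OF shiftn_in[OF w, of j] Y(1)] by (simp add: z_def)
  qed
  then have "is_path M k z" using tauz by (simp add: is_path_def z_def)
  moreover have "action M lam A k z = S m k w"
    unfolding action_def S_def
    using sum.atLeast1_atMost_eq[of "\<lambda>i. A (z i) - m" k] Y(2) by (simp add: z_def)
  ultimately show ?thesis by (intro exI[of _ z]) (simp add: z_def)
qed

text \<open>Steps by \<open>tau\<close> read from the other end are shifts. The pasts along a given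
  path need not be optimal, which leaves an inequality where \<open>path_of_orbit\<close> has
  equality.\<close>

lemma orbit_of_path:
  assumes z: "is_path M k z"
  shows "snd (z 0) \<in> \<Sigma>" "snd (z k) = shiftn k (snd (z 0))" "S m k (snd (z 0)) \<le> action M lam A k z"
proof -
  let ?w = "snd (z 0)"
  have hat: "z i \<in> hat_space M" if "i \<le> k" for i using z that by (simp add: is_path_def)
  show "?w \<in> \<Sigma>" using hat[of 0] by (auto simp: hat_space_def)
  have step: "snd (z i) = tau (fst (z (Suc i))) (snd (z (Suc i)))" if "i < k" for i
    using z that by (simp add: is_path_def)
  have shiftn: "snd (z i) = shiftn i ?w" if "i \<le> k" for i
    using that
  proof (induction i)
    case (Suc i)
    then have "snd (z (Suc i)) = shiftn (Suc 0) (snd (z i))" by (subst step) auto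
    then show ?case using Suc by simp
  qed simp
  from shiftn[OF order_refl] show "snd (z k) = shiftn k ?w" .
  have "B (shiftn i ?w) - m \<le> A (z (Suc i)) - m" if "i < k" for i
  proof -
    have "tau (fst (z (Suc i))) (snd (z (Suc i))) = shiftn i ?w"
      by (rule trans[OF step[OF that, symmetric] shiftn[OF less_imp_le[OF that]]])
    moreover have "(fst (z (Suc i)), snd (z (Suc i))) \<in> hat_space M" using hat[of "Suc i"] that by simp
    ultimately show ?thesis using B_le_A[of "fst (z (Suc i))" "snd (z (Suc i))"] by simp
  qed
  then have "S m k ?w \<le> (\<Sum>i<k. A (z (Suc i)) - m)"
    unfolding S_def by (intro sum_mono) auto
  then show "S m k ?w \<le> action M lam A k z"
    by (simp add: action_def sum.atLeast1_atMost_eq)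
qed

section \<open>The barrier expressed by \<open>cost\<close>\<close>

definition near :: "'s seq \<Rightarrow> nat \<Rightarrow> 's seq \<Rightarrow> bool" where
  "near x = (\<lambda>n w. agree n w x)"

lemma prefix_local_near: "prefix_local (near x)"
  unfolding near_def by (rule prefix_local_agree)

lemma liminf_le_iff_real:
  fixes f :: "nat \<Rightarrow> ereal"
  shows "liminf f \<le> ereal t \<longleftrightarrow> (\<forall>e>0. \<forall>n. \<exists>k\<ge>n. f k < ereal (t + e))"
proof
  assume le: "liminf f \<le> ereal t"
  show "\<forall>e>0. \<forall>n. \<exists>k\<ge>n. f k < ereal (t + e)"
  proof (intro allI impI, rule ccontr)
    fix e :: real and n assume "0 < e" "\<not> (\<exists>k\<ge>n. f k < ereal (t + e))"
    then have "\<forall>\<^sub>F k in sequentially. ereal (t + e) \<le> f k"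
      unfolding eventually_sequentially by (meson not_le)
    then have "ereal (t + e) \<le> ereal t" using Liminf_bounded le order_trans by blast
    then show False using \<open>0 < e\<close> by simp
  qed
next
  assume R: "\<forall>e>0. \<forall>n. \<exists>k\<ge>n. f k < ereal (t + e)"
  show "liminf f \<le> ereal t"
  proof (rule ccontr)
    assume "\<not> ?thesis"
    then obtain s where s: "ereal t < ereal s" "ereal s < liminf f"
      using ereal_dense2[of "ereal t" "liminf f"] by (auto simp: not_le)
    then obtain n where "\<And>k. n \<le> k \<Longrightarrow> ereal s < f k"
      using less_LiminfD[OF s(2)] unfolding eventually_sequentially by blast
    moreover obtain k where "k \<ge> n" "f k < ereal (t + (s - t))"
      using R[rule_format, of "s - t" n] s(1) by auto
    moreover have "t + (s - t) = s" by simp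
    ultimately show False using less_asym by metis
  qed
qed

lemma Lim_at_right_antimono:
  fixes F :: "real \<Rightarrow> ereal"
  assumes "\<And>a b. 0 < a \<Longrightarrow> a \<le> b \<Longrightarrow> F b \<le> F a"
  shows "Lim (at_right 0) F = (SUP e\<in>{0<..}. F e)"
proof (rule tendsto_Lim)
  show "(F \<longlongrightarrow> (SUP e\<in>{0<..}. F e)) (at_right 0)"
  proof (rule increasing_tendsto)
    show "\<forall>\<^sub>F e in at_right 0. F e \<le> (SUP e\<in>{0<..}. F e)"
      using eventually_at_right_less[of "0::real"] by eventually_elim (auto intro: SUP_upper)
    fix y assume "y < (SUP e\<in>{0<..}. F e)"
    then obtain b where b: "0 < b" "y < F b" by (auto simp: less_SUP_iff)
    have "\<forall>\<^sub>F e in at_right 0. e \<in> {0<..<b}" using b(1) by (rule eventually_at_right_real)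
    then show "\<forall>\<^sub>F e in at_right 0. y < F e"
      by eventually_elim (use assms b in \<open>force intro: less_le_trans\<close>)
  qed
qed simp

text \<open>Monotonicity in \<epsilon> turns the limit into a supremum. The substantial direction is
  from paths to \<open>cost\<close>, where the approximate endpoint is replaced by \<open>x'\<close>
  itself at the price of a small distortion.\<close>

lemma peierls_le_iff:
  assumes x: "x' \<in> \<Sigma>"
  shows "peierls M lam A x x' \<le> ereal t \<longleftrightarrow> cost (near x) x' t"
proof -
  let ?F = "\<lambda>e. liminf (\<lambda>k. S_eps M lam A e x x' k)"
  have anti: "?F b \<le> ?F a" if "0 < a" "a \<le> b" for a b
  proof (intro Liminf_mono always_eventually allI)
    fix k
    have "paths M lam k x x' a \<subseteq> paths M lam k x x' b" using that by (auto simp: paths_def)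
    then show "S_eps M lam A b x x' k \<le> S_eps M lam A a x x' k"
      unfolding S_eps_def by (intro INF_superset_mono) auto
  qed
  have S_less: "S_eps M lam A e x x' k < ereal s \<longleftrightarrow> (\<exists>z\<in>paths M lam k x x' e. action M lam A k z < s)"
    for e k s by (simp add: S_eps_def INF_less_iff)
  have "peierls M lam A x x' \<le> ereal t \<longleftrightarrow> (\<forall>e>0. ?F e \<le> ereal t)"
    unfolding peierls_def using anti by (subst Lim_at_right_antimono) (auto simp: SUP_le_iff)
  also have "\<dots> \<longleftrightarrow> (\<forall>e>0. \<forall>d>0. \<forall>n. \<exists>k\<ge>n. \<exists>z\<in>paths M lam k x x' e. action M lam A k z < t + d)"
    by (simp add: liminf_le_iff_real S_less)
  also have "\<dots> \<longleftrightarrow> cost (near x) x' t"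
  proof
    assume L: "\<forall>e>0. \<forall>d>0. \<forall>n. \<exists>k\<ge>n. \<exists>z\<in>paths M lam k x x' e. action M lam A k z < t + d"
    show "cost (near x) x' t"
      unfolding cost_def near_def
    proof (intro allI impI)
      fix n and d :: real assume "0 < d"
      then obtain q where q: "D * \<theta> ^ q < d / 2" using theta_small[of "d/2"] by auto
      \<comment> \<open>This provides a distortion below \<open>d / 2\<close>, a start agreeing with
        \<open>x\<close> up to \<open>n\<close>, and a positive overlap at the joint.\<close>
      define N where "N = Suc (max n q)"
      have "\<theta> ^ N \<le> \<theta> ^ q" using \<theta> by (intro power_decreasing) (auto simp: N_def)
      then have N: "D * \<theta> ^ N < d / 2" using q D_nonneg mult_left_mono by fastforce
      obtain k z where z: "k \<ge> n" "z \<in> paths M lam k x x' (lam ^ N)" "action M lam A k z < t + d / 2"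
        using L[rule_format, of "lam ^ N" "d / 2" n] lam \<open>0 < d\<close> by auto
      let ?w = "snd (z 0)"
      have path: "is_path M k z" and agree: "agree N ?w x" "agree N (snd (z k)) x'"
        using z(2) shift_dist_lt_imp_agree[OF lam] by (auto simp: paths_def)
      note w = orbit_of_path[OF path]
      let ?v = "glue k ?w x'"
      have agk: "agree N (shiftn k ?w) x'" using agree(2) w(2) by simp
      have v: "?v \<in> \<Sigma>" using x w(1) agk by (rule glue_in_agree) (simp add: N_def)
      have agv: "agree (k + N) ?v ?w" using agk by (rule agree_glue)
      have "S m k ?v \<le> S m k ?w + D * \<theta> ^ N" using v w(1) agv by (rule S_distortion)
      then have "S m k ?v < t + d" using w(3) z(3) N by linarith
      moreover have "agree n ?v x"
        by (rule agree_trans[OF agree_mono[OF agv] agree_mono[OF agree(1)]]) (auto simp: N_def)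
      ultimately show "\<exists>k\<ge>n. \<exists>w\<in>\<Sigma>. agree n w x \<and> shiftn k w = x' \<and> S m k w < t + d"
        using v z(1) by (intro exI[of _ k] conjI bexI[of _ ?v]) auto
    qed
  next
    assume R: "cost (near x) x' t"
    show "\<forall>e>0. \<forall>d>0. \<forall>n. \<exists>k\<ge>n. \<exists>z\<in>paths M lam k x x' e. action M lam A k z < t + d"
    proof (intro allI impI)
      fix e d :: real and n assume "0 < e" "0 < d"
      obtain N where N: "\<And>u v :: 's seq. agree N u v \<Longrightarrow> shift_dist lam u v < e"
        using shift_dist_lt_if_agree[OF lam \<open>0 < e\<close>] by metis
      \<comment> \<open>The prefix index of \<open>cost\<close> is also its length bound, so
        \<open>max n N\<close> meets both demands.\<close>
      obtain k w where w: "max n N \<le> k" "w \<in> \<Sigma>" "near x (max n N) w" "shiftn k w = x'" "S m k w < t + d"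
        using costE[OF R \<open>0 < d\<close>] by metis
      have "agree N w x" using w(3) agree_mono unfolding near_def by (metis max.cobounded2)
      then have "shift_dist lam w x < e" "shift_dist lam x' x' < e" using N by auto
      moreover obtain z where "is_path M k z" "snd (z 0) = w" "snd (z k) = shiftn k w" "action M lam A k z = S m k w"
        using path_of_orbit[OF w(2)] by metis
      ultimately have "z \<in> paths M lam k x x' e" "action M lam A k z < t + d"
        using w by (auto simp: paths_def)
      then show "\<exists>k\<ge>n. \<exists>z\<in>paths M lam k x x' e. action M lam A k z < t + d" using w(1) by auto
    qed
  qed
  finally show ?thesis .
qed

section \<open>The real-valued barrier from non-wandering points\<close>

definition h :: "'s seq \<Rightarrow> 's seq \<Rightarrow> real" where
  "h x = min_cost (near x)"

abbreviation "\<Omega> \<equiv> nonwandering M lam A"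

lemma nonwandering_in: "x \<in> \<Omega> \<Longrightarrow> x \<in> \<Sigma>"
  by (simp add: nonwandering_def)

text \<open>A return to \<open>x\<close> of small cost may have bounded length; repeating its word yields arbitrarily long
  returns.\<close>

lemma cost_nonwandering:
  assumes x: "x \<in> \<Omega>"
  shows "cost (near x) x 0"
  unfolding cost_def near_def
proof (intro allI impI)
  fix n and e :: real assume "0 < e"
  define N where "N = Suc n"
  \<comment> \<open>A return will cost less than \<open>2 * d\<close>, gluing error included, so
    \<open>N\<close> of them cost less than \<open>e\<close>.\<close>
  define d where "d = e / (2 * real N)"
  have d: "0 < d" using \<open>0 < e\<close> by (simp add: d_def N_def)
  then obtain q where q: "D * \<theta> ^ q < d" using theta_small by auto
  define l where "l = Suc (max n q)"
  have "\<theta> ^ l \<le> \<theta> ^ q" using \<theta> by (intro power_decreasing) (auto simp: l_def)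
  then have l: "D * \<theta> ^ l < d" using q D_nonneg mult_left_mono by fastforce
  have "0 < min (lam ^ l) d" using d lam by simp
  then obtain k z where k: "1 \<le> k" and z: "z \<in> paths M lam k x x (min (lam ^ l) d)"
      and act: "\<bar>action M lam A k z\<bar> < min (lam ^ l) d"
    using x unfolding nonwandering_def by blast
  let ?w = "snd (z 0)"
  have path: "is_path M k z" and agree: "agree l ?w x" "agree l (snd (z k)) x"
    using z shift_dist_lt_imp_agree[OF lam] by (auto simp: paths_def)
  note w = orbit_of_path[OF path]
  define c where "c = S m k ?w + D * \<theta> ^ l"
  have c: "c < 2 * d" using w(3) act l unfolding c_def by linarith
  \<comment> \<open>Each repetition is glued in front, so the endpoint remains exactly
    \<open>x\<close> and the new start is again close to \<open>x\<close>.\<close>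
  have "\<exists>v\<in>\<Sigma>. agree l v x \<and> shiftn (j * k) v = x \<and> S m (j * k) v \<le> real j * c" for j
  proof (induction j)
    case 0
    show ?case using nonwandering_in[OF x] by (intro bexI[of _ x]) auto
  next
    case (Suc j)
    then obtain v where v: "v \<in> \<Sigma>" "agree l v x" "shiftn (j * k) v = x" "S m (j * k) v \<le> real j * c" by blast
    let ?v = "glue k ?w v"
    have agk: "agree l (shiftn k ?w) v" using agree(2) w(2) v(2) agree_trans agree_sym by metis
    have v': "?v \<in> \<Sigma>" using v(1) w(1) agk by (rule glue_in_agree) (simp add: l_def)
    have agv: "agree (k + l) ?v ?w" using agk by (rule agree_glue)
    have "S m k ?v \<le> c" unfolding c_def using v' w(1) agv by (rule S_distortion)
    then have "S m (Suc j * k) ?v \<le> real (Suc j) * c"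
      using v(4) S_add[of m k "j * k" ?v] by (simp add: algebra_simps)
    moreover have "agree l ?v x" using agree_mono[OF agv, of l] agree(1) agree_trans by auto
    moreover have "shiftn (Suc j * k) ?v = x"
      using v(3) by (metis add.commute mult_Suc shiftn_glue shiftn_shiftn)
    ultimately show ?case using v' by blast
  qed
  then obtain v where v: "v \<in> \<Sigma>" "agree l v x" "shiftn (N * k) v = x" "S m (N * k) v \<le> real N * c" by blast
  have "real N * c < real N * (2 * d)" using c by (simp add: N_def)
  also have "\<dots> = e"
  proof -
    have "real N \<noteq> 0" by (simp add: N_def)
    then show ?thesis by (simp add: d_def)
  qed
  finally have "S m (N * k) v < 0 + e" using v(4) by simp
  moreover have "n \<le> N * k" using mult_le_mono2[OF k, of N] by (simp add: N_def)
  moreover have "agree n v x" using v(2) by (rule agree_mono) (simp add: l_def)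
  ultimately show "\<exists>k\<ge>n. \<exists>w\<in>\<Sigma>. agree n w x \<and> shiftn k w = x \<and> S m k w < 0 + e"
    using v by blast
qed

lemma h_le_iff:
  assumes "x \<in> \<Omega>" "x' \<in> \<Sigma>"
  shows "h x x' \<le> t \<longleftrightarrow> cost (near x) x' t"
  unfolding h_def
  using cost_finite[OF prefix_local_near cost_nonwandering] cost_iff assms by metis

text \<open>For non-wandering \<open>x\<close> the returns of cost 0 make \<open>cost\<close> finite
  at every endpoint, so \<open>h\<close> loses nothing. Where the barrier is infinite,
  \<open>h\<close> would be the \<open>Inf\<close> of an empty set.\<close>

lemma peierls_eq:
  assumes "x \<in> \<Omega>" "x' \<in> \<Sigma>"
  shows "peierls M lam A x x' = ereal (h x x')"
proof -
  have iff: "peierls M lam A x x' \<le> ereal t \<longleftrightarrow> h x x' \<le> t" for t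
    using peierls_le_iff h_le_iff assms by blast
  show ?thesis
  proof (cases "peierls M lam A x x'")
    case (real s)
    then show ?thesis using iff[of s] iff[of "h x x'"] by simp
  next
    case PInf
    then show ?thesis using iff[of "h x x'"] by simp
  next
    case MInf
    then show ?thesis using iff[of "h x x' - 1"] by simp
  qed
qed

lemma h_calibrated: "x \<in> \<Omega> \<Longrightarrow> calibrated_sub_action M lam A (h x)"
  unfolding h_def using min_cost_calibrated[OF prefix_local_near cost_nonwandering] .

lemma sub_action_S:
  assumes "sub_action M lam A u" "w \<in> \<Sigma>"
  shows "u (shiftn k w) - u w \<le> S m k w"
proof (induction k)
  case (Suc k)
  have "u (shiftn (Suc k) w) \<le> u (shiftn k w) + B (shiftn k w) - m"
    using bspec[OF conjunct2[OF assms(1)[unfolded sub_action_iff]] shiftn_in[OF assms(2), of k]] by simp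
  then show ?case using Suc by (simp add: S_def)
qed simp

text \<open>Along an orbit from near \<open>x\<close> to \<open>x'\<close> the increase of
  \<open>u\<close> is at most the sum \<open>S m k w\<close>, and continuity at \<open>x\<close>
  replaces the starting value by \<open>u x\<close>.\<close>

lemma sub_action_le_h:
  assumes u: "sub_action M lam A u" and x: "x \<in> \<Omega>" "x' \<in> \<Sigma>"
  shows "u x' - u x \<le> h x x'"
proof (rule field_le_epsilon)
  fix e :: real assume "0 < e"
  then have "0 < e / 2" by simp
  then obtain n where n: "\<forall>y\<in>\<Sigma>. agree n x y \<longrightarrow> \<bar>u x - u y\<bar> < e / 2"
    using u nonwandering_in[OF x(1)] unfolding sub_action_iff continuous_on_shift_iff[OF lam] by blast
  have "cost (near x) x' (h x x')" using h_le_iff[OF x] by blast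
  then obtain k w where w: "n \<le> k" "w \<in> \<Sigma>" "near x n w" "shiftn k w = x'" "S m k w < h x x' + e / 2"
    using costE[of "near x" x' "h x x'" "e / 2" n] \<open>0 < e\<close> by auto
  have "\<bar>u x - u w\<bar> < e / 2" using n w(2,3) agree_sym by (auto simp: near_def)
  then show "u x' - u x \<le> h x x' + e" using sub_action_S[OF u w(2), of k] w(5) unfolding w(4) by linarith
qed

text \<open>Instead of concatenating paths, apply \<open>sub_action_le_h\<close> to
  \<open>h x\<close>, which is itself a sub-action.\<close>

lemma h_triangle:
  assumes "x \<in> \<Omega>" "y \<in> \<Omega>" "z \<in> \<Sigma>"
  shows "h x z \<le> h x y + h y z"
  using sub_action_le_h[OF _ assms(2,3), of "h x"] h_calibrated[OF assms(1)]
  by (simp add: calibrated_sub_action_def)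

lemma h_self: "x \<in> \<Omega> \<Longrightarrow> h x x = 0"
  using h_le_iff[of x x 0] cost_nonwandering[of x] nonwandering_in[of x] h_triangle[of x x x] by fastforce

text \<open>Following the calibration backwards from \<open>x\<close> produces an orbit along which the sums telescope;
  every cluster point of it is non-wandering and attains the minimum.\<close>

lemma calibrated_attained:
  assumes u: "calibrated_sub_action M lam A u" and x: "x \<in> \<Sigma>"
  shows "\<exists>p\<in>\<Omega>. u p + h p x \<le> u x"
proof -
  have "\<exists>X. \<forall>n. (X n \<in> \<Sigma> \<and> (n = 0 \<longrightarrow> X n = x)) \<and>
      shiftn (Suc 0) (X (Suc n)) = X n \<and> u (X n) = u (X (Suc n)) + B (X (Suc n)) - m"
  proof (rule dependent_nat_choice)
    show "\<exists>w. w \<in> \<Sigma> \<and> ((0::nat) = 0 \<longrightarrow> w = x)" using x by blast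
  next
    fix w and n :: nat assume "w \<in> \<Sigma> \<and> (n = 0 \<longrightarrow> w = x)"
    then obtain v where "v \<in> \<Sigma>" "shiftn (Suc 0) v = w" "u w = u v + B v - m"
      using u[unfolded calibrated_iff, THEN conjunct2, rule_format, of w] by blast
    then show "\<exists>v. (v \<in> \<Sigma> \<and> (Suc n = 0 \<longrightarrow> v = x)) \<and> shiftn (Suc 0) v = w \<and> u w = u v + B v - m"
      by (intro exI[of _ v]) simp
  qed
  then obtain X where X: "\<And>n. X n \<in> \<Sigma>" "X 0 = x" "\<And>n. shiftn (Suc 0) (X (Suc n)) = X n"
      "\<And>n. u (X n) = u (X (Suc n)) + B (X (Suc n)) - m"
    by auto
  have sumX: "shiftn k (X (k + i)) = X i \<and> S m k (X (k + i)) = u (X i) - u (X (k + i))" for k i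
  proof (induction k)
    case (Suc k)
    have "shiftn (Suc k) (X (Suc k + i)) = X i"
      using Suc X(3)[of "k + i"] by (metis add_Suc plus_1_eq_Suc add.commute shiftn_shiftn One_nat_def)
    moreover have "S m (Suc k) (X (Suc k + i)) = B (X (Suc k + i)) - m + S m k (X (k + i))"
      using S_add[of m "Suc 0" k "X (Suc k + i)"] X(3)[of "k + i"] by (simp add: S_1)
    ultimately show ?case using Suc X(4)[of "k + i"] by simp
  qed simp
  obtain p where p: "\<And>n. infinite {k. agree n (X k) p}" using cluster_point by blast
  have pk: "\<exists>k\<ge>N. agree n (X k) p" for n N
    using p[of n] by (meson infinite_nat_iff_unbounded_le mem_Collect_eq)
  have pS: "p \<in> \<Sigma>" using pk X(1) by (intro closed_shift) blast
  have uc: "continuous_on_shift M lam u" using u by (simp add: calibrated_iff sub_action_iff)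
  have cont: "\<exists>n\<ge>N. \<forall>k. agree n (X k) p \<longrightarrow> \<bar>u p - u (X k)\<bar> < e" if e: "0 < e" for e :: real and N
  proof -
    obtain n where n: "\<forall>y\<in>\<Sigma>. agree n p y \<longrightarrow> \<bar>u p - u y\<bar> < e"
      using uc[unfolded continuous_on_shift_iff[OF lam], rule_format, OF pS e] by blast
    have "\<bar>u p - u (X k)\<bar> < e" if "agree (max N n) (X k) p" for k
      using n X(1)[of k] agree_sym[OF agree_mono[OF that]] by simp
    then show ?thesis by (intro exI[of _ "max N n"]) simp
  qed
  have "p \<in> \<Omega>"
    unfolding nonwandering_def
  proof (intro CollectI conjI pS allI impI)
    fix e :: real assume e: "0 < e"
    obtain N where N: "\<And>u v :: 's seq. agree N u v \<Longrightarrow> shift_dist lam u v < e"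
      using shift_dist_lt_if_agree[OF lam e] by metis
    obtain n where n: "N \<le> n" "\<forall>k. agree n (X k) p \<longrightarrow> \<bar>u p - u (X k)\<bar> < e / 2"
      using cont[of "e/2" N] e by auto
    obtain i where i: "agree n (X i) p" using pk by blast
    \<comment> \<open>Two visits \<open>i < j\<close> to one cylinder around \<open>p\<close> bound
      an orbit segment from \<open>X j\<close> to \<open>X i\<close>. Its sum is
      \<open>u (X i) - u (X j)\<close>, small by continuity.\<close>
    obtain j where j: "j \<ge> Suc i" "agree n (X j) p" using pk by blast
    define k where "k = j - i"
    have k: "1 \<le> k" "j = k + i" using j(1) by (auto simp: k_def)
    obtain z where z: "is_path M k z" "snd (z 0) = X j" "snd (z k) = shiftn k (X j)" "action M lam A k z = S m k (X j)"
      using path_of_orbit[OF X(1)] by metis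
    have "z \<in> paths M lam k p p e"
      using z N agree_mono[OF i n(1)] agree_mono[OF j(2) n(1)] sumX[of k i] k by (simp add: paths_def)
    moreover have "\<bar>u (X i) - u (X j)\<bar> < e"
      using n(2)[rule_format, OF i] n(2)[rule_format, OF j(2)] by linarith
    then have "\<bar>action M lam A k z\<bar> < e" using z(4) sumX[of k i] k(2) by simp
    ultimately show "\<exists>k\<ge>1. \<exists>z\<in>paths M lam k p p e. \<bar>action M lam A k z\<bar> < e" using k(1) by blast
  qed
  \<comment> \<open>Now the segment runs from \<open>X k\<close>, close to \<open>p\<close>, all the
    way to \<open>X 0 = x\<close>.\<close>
  moreover have "cost (near p) x (u x - u p)"
    unfolding cost_def near_def
  proof (intro allI impI)
    fix N and e :: real assume "0 < e"
    then obtain n where n: "N \<le> n" "\<forall>k. agree n (X k) p \<longrightarrow> \<bar>u p - u (X k)\<bar> < e" using cont by blast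
    obtain k where k: "k \<ge> N" "agree n (X k) p" using pk by blast
    then have "\<bar>u p - u (X k)\<bar> < e" using n(2) by blast
    then have "S m k (X k) < u x - u p + e" using sumX[of k 0] X(2) by simp
    then show "\<exists>k\<ge>N. \<exists>w\<in>\<Sigma>. agree N w p \<and> shiftn k w = x \<and> S m k w < u x - u p + e"
      using k agree_mono[OF k(2) n(1)] sumX[of k 0] X(1,2) by (intro exI[of _ k] conjI bexI[of _ "X k"]) auto
  qed
  ultimately show ?thesis using h_le_iff[of p x "u x - u p"] x by (intro bexI[of _ p]) simp_all
qed

lemma nonwandering_nonempty: "\<Omega> \<noteq> {}"
  using calibrated_exists calibrated_attained shift_space_nonempty by blast

section \<open>Irreducible components\<close>

text \<open>A class is given through one representative \<open>a\<close>; the triangle inequality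
  through \<open>a\<close> bounds the sum above by 0, and \<open>h_self\<close> bounds it
  below.\<close>

lemma component_members:
  assumes C: "C \<in> irreducible_components M lam A" and xy: "x \<in> C" "y \<in> C"
  shows "x \<in> \<Omega>" "y \<in> \<Omega>" "h x y + h y x = 0"
proof -
  obtain a where a: "a \<in> \<Omega>" and CC: "C = {z \<in> \<Omega>. peierls M lam A a z + peierls M lam A z a = 0}"
    using C by (auto simp: irreducible_components_def quotient_def Image_def)
  show mem: "x \<in> \<Omega>" "y \<in> \<Omega>" using xy CC by auto
  have "h a x + h x a = 0" "h a y + h y a = 0"
    using xy CC mem a nonwandering_in by (auto simp: peierls_eq zero_ereal_def)
  moreover have "h x y \<le> h x a + h a y" "h y x \<le> h y a + h a x" "h x x \<le> h x y + h y x"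
    using mem a nonwandering_in by (auto intro!: h_triangle)
  ultimately show "h x y + h y x = 0" using h_self[OF mem(1)] by linarith
qed

lemma component_closed:
  assumes C: "C \<in> irreducible_components M lam A" and x: "x \<in> C"
    and y: "y \<in> \<Omega>" "h x y + h y x = 0"
  shows "y \<in> C"
proof -
  obtain a where a: "a \<in> \<Omega>" and CC: "C = {z \<in> \<Omega>. peierls M lam A a z + peierls M lam A z a = 0}"
    using C by (auto simp: irreducible_components_def quotient_def Image_def)
  have mem: "x \<in> \<Omega>" using x CC by auto
  have "h a x + h x a = 0"
    using x CC mem a nonwandering_in by (auto simp: peierls_eq zero_ereal_def)
  moreover have "h a y \<le> h a x + h x y" "h y a \<le> h y x + h x a" "h y y \<le> h y a + h a y"
    using mem a y nonwandering_in by (auto intro!: h_triangle)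
  ultimately have "h a y + h y a = 0" using h_self[OF y(1)] y(2) by linarith
  then show ?thesis using CC y(1) a nonwandering_in by (simp add: peierls_eq zero_ereal_def)
qed

section \<open>Minima of calibrated sub-actions\<close>

lemma calibrated_min:
  assumes a: "calibrated_sub_action M lam A a" and b: "calibrated_sub_action M lam A b"
  shows "calibrated_sub_action M lam A (\<lambda>x. min (a x) (b x))"
proof -
  have ca: "continuous_on_shift M lam a" and cb: "continuous_on_shift M lam b"
    using a b by (simp_all add: calibrated_iff sub_action_iff)
  have la: "a (shiftn (Suc 0) w) \<le> a w + B w - m" and lb: "b (shiftn (Suc 0) w) \<le> b w + B w - m" if "w \<in> \<Sigma>" for w
    using a b that by (simp_all add: calibrated_iff sub_action_iff)
  have "continuous_on_shift M lam (\<lambda>x. min (a x) (b x))"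
    using ca cb unfolding continuous_on_shift_def by (intro continuous_map_real_min)
  moreover have "min (a (shiftn (Suc 0) w)) (b (shiftn (Suc 0) w)) \<le> min (a w) (b w) + B w - m" if "w \<in> \<Sigma>" for w
    using la[OF that] lb[OF that] by linarith
  moreover have "\<exists>w\<in>\<Sigma>. shiftn (Suc 0) w = x \<and> min (a x) (b x) = min (a w) (b w) + B w - m" if x: "x \<in> \<Sigma>" for x
  proof -
    \<comment> \<open>A preimage \<open>w\<close> calibrating the function that is smaller at
      \<open>x\<close> works for the minimum: the inequality for the other function keeps it from
      being strictly smaller at \<open>w\<close>.\<close>
    have *: "\<exists>w\<in>\<Sigma>. shiftn (Suc 0) w = x \<and> min (a' x) (b' x) = min (a' w) (b' w) + B w - m"
      if a': "\<exists>w\<in>\<Sigma>. shiftn (Suc 0) w = x \<and> a' x = a' w + B w - m"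
        and b': "\<And>w. w \<in> \<Sigma> \<Longrightarrow> b' (shiftn (Suc 0) w) \<le> b' w + B w - m" and le: "a' x \<le> b' x" for a' b'
    proof -
      obtain w where w: "w \<in> \<Sigma>" "shiftn (Suc 0) w = x" "a' x = a' w + B w - m" using a' by blast
      have "b' x \<le> b' w + B w - m" using b'[OF w(1)] w(2) by simp
      then have "min (a' x) (b' x) = min (a' w) (b' w) + B w - m" using w(3) le by linarith
      then show ?thesis using w(1,2) by blast
    qed
    have "\<exists>w\<in>\<Sigma>. shiftn (Suc 0) w = x \<and> a x = a w + B w - m" "\<exists>w\<in>\<Sigma>. shiftn (Suc 0) w = x \<and> b x = b w + B w - m"
      using a b x unfolding calibrated_iff by blast+
    then show ?thesis using *[of a b] *[of b a] la lb by (cases "a x \<le> b x") (simp_all add: min.commute)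
  qed
  ultimately show ?thesis unfolding calibrated_iff sub_action_iff by blast
qed

lemma calibrated_add_const:
  assumes "calibrated_sub_action M lam A a"
  shows "calibrated_sub_action M lam A (\<lambda>x. c + a x)"
proof -
  have "continuous_on_shift M lam (\<lambda>x. c + a x)"
    using assms unfolding calibrated_iff sub_action_iff continuous_on_shift_def
    by (intro continuous_intros) auto
  moreover have "c + s \<le> c + t + B w - m \<longleftrightarrow> s \<le> t + B w - m" "c + s = c + t + B w - m \<longleftrightarrow> s = t + B w - m"
    for s t w by linarith+
  ultimately show ?thesis using assms unfolding calibrated_iff sub_action_iff by simp
qed

lemma calibrated_Min:
  assumes "finite I" "I \<noteq> {}" "\<And>i. i \<in> I \<Longrightarrow> calibrated_sub_action M lam A (v i)"
  shows "calibrated_sub_action M lam A (\<lambda>x. Min ((\<lambda>i. c i + v i x) ` I))"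
  using assms
proof (induction rule: finite_ne_induct)
  case (singleton i)
  then show ?case by (simp add: calibrated_add_const)
next
  case (insert i I)
  have "(\<lambda>x. Min ((\<lambda>i. c i + v i x) ` insert i I)) = (\<lambda>x. min (c i + v i x) (Min ((\<lambda>i. c i + v i x) ` I)))"
    using insert.hyps by simp
  then show ?case using insert by (simp only:) (intro calibrated_min calibrated_add_const, auto)
qed

end

text \<open>Agreement in \<open>n\<close> symbols makes \<open>hat_dist\<close> at most
  \<open>lam ^ n\<close>, whose power with exponent \<alpha> is
  \<open>(lam powr \<alpha>) ^ n\<close>. The absolute value of \<open>K\<close> meets the sign
  condition of the locale.\<close>

lemma holder_subshift_exists:
  fixes M :: "nat^'s^'s::finite"
  assumes M: "transition_matrix M" "irreducible_matrix M" and lam: "0 < lam" "lam < 1"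
    and A: "holder_observable M lam A"
  shows "\<exists>K \<theta>. holder_subshift M lam A K \<theta>"
proof -
  obtain \<alpha> K where \<alpha>: "0 < \<alpha>" "\<alpha> \<le> 1"
    and K: "\<And>z z'. z \<in> hat_space M \<Longrightarrow> z' \<in> hat_space M \<Longrightarrow> \<bar>A z - A z'\<bar> \<le> K * hat_dist lam z z' powr \<alpha>"
    using A unfolding holder_observable_def by blast
  have "holder_subshift M lam A \<bar>K\<bar> (lam powr \<alpha>)"
  proof
    have "lam powr \<alpha> < 1 powr \<alpha>" using lam \<alpha> by (intro powr_less_mono2) auto
    then show "lam powr \<alpha> < 1" by simp
    fix z z' and n
    assume z: "z \<in> hat_space M" "z' \<in> hat_space M" and agree: "agree n (fst z) (fst z')" "agree n (snd z) (snd z')"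
    have *: "shift_dist lam (fst z) (fst z') \<le> lam ^ n" "shift_dist lam (snd z) (snd z') \<le> lam ^ n"
      using agree shift_dist_le_iff[OF lam] by blast+
    have "lam * shift_dist lam (fst z) (fst z') \<le> 1 * lam ^ n"
      using *(1) lam by (intro mult_mono shift_dist_nonneg) auto
    then have "hat_dist lam z z' \<le> lam ^ n" using *(2) by (simp add: hat_dist_def past_dist_eq)
    moreover have "0 \<le> hat_dist lam z z'"
      using shift_dist_nonneg[OF lam(1), of "snd z" "snd z'"] by (simp add: hat_dist_def le_max_iff_disj)
    ultimately have "hat_dist lam z z' powr \<alpha> \<le> (lam ^ n) powr \<alpha>"
      using \<alpha> by (intro powr_mono2) auto
    also have "\<dots> = (lam powr \<alpha>) ^ n"
      using lam by (simp add: powr_powr mult.commute flip: powr_realpow)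
    finally have "K * hat_dist lam z z' powr \<alpha> \<le> \<bar>K\<bar> * (lam powr \<alpha>) ^ n"
      by (intro mult_mono) auto
    then show "\<bar>A z - A z'\<bar> \<le> \<bar>K\<bar> * (lam powr \<alpha>) ^ n" using K[OF z] by linarith
  qed (use M lam in auto)
  then show ?thesis by blast
qed

section \<open>Proof of the three claims\<close>

lemma Min_image_eq:
  fixes f :: "'i \<Rightarrow> 'b::linorder"
  assumes "finite I" "\<And>i. i \<in> I \<Longrightarrow> a \<le> f i" "i0 \<in> I" "f i0 \<le> a"
  shows "a = (MIN i\<in>I. f i)"
  using assms by (intro Min_eqI[symmetric]) (auto intro!: image_eqI[of _ _ i0] antisym)

theorem theorem12:
  fixes M :: "nat^'s^'s::finite" and lam :: real
    and A :: "'s seq \<times> 's seq \<Rightarrow> real"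
    and r :: nat and C :: "nat \<Rightarrow> 's seq set" and xb :: "nat \<Rightarrow> 's seq"
  assumes "transition_matrix M" and "irreducible_matrix M"
    and "0 < lam" and "lam < 1"
    and "holder_observable M lam A"
    and "\<forall>i\<in>{1..r}. C i \<in> irreducible_components M lam A"
    and "disjoint_family_on C {1..r}"
    and "nonwandering M lam A = (\<Union>i\<in>{1..r}. C i)"
    and "\<forall>i\<in>{1..r}. xb i \<in> C i"
  shows
    "(\<forall>u. calibrated_sub_action M lam A u \<longrightarrow>
        (\<lambda>i. u (xb i)) \<in> constraint_set M lam A r xb \<and>
        (\<forall>x\<in>shift_space M.
           ereal (u x) = (MIN i\<in>{1..r}. ereal (u (xb i)) + peierls M lam A (xb i) x)))
     \<and>
     (\<forall>w\<in>constraint_set M lam A r xb.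
        \<exists>u. (\<forall>x\<in>shift_space M.
               ereal (u x) = (MIN i\<in>{1..r}. ereal (w i) + peierls M lam A (xb i) x)) \<and>
            calibrated_sub_action M lam A u \<and>
            (\<forall>i\<in>{1..r}. u (xb i) = w i))
     \<and>
     (\<forall>i0\<in>{1..r}. \<forall>w :: nat \<Rightarrow> real.
        (\<forall>i\<in>{1..r}. ereal (w i) = ereal (w i0) + peierls M lam A (xb i0) (xb i)) \<longrightarrow>
        (\<forall>j\<in>{1..r}.
           (\<forall>i\<in>{1..r}. ereal (w i) = ereal (w j) + peierls M lam A (xb j) (xb i)) \<longrightarrow> j = i0) \<and>
        w \<in> constraint_set M lam A r xb \<and>
        (\<exists>u. calibrated_sub_action M lam A u \<and>
             (\<forall>i\<in>{1..r}. u (xb i) = w i) \<and>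
             (\<forall>x\<in>shift_space M. ereal (u x) = ereal (w i0) + peierls M lam A (xb i0) x)) \<and>
        (\<forall>v. calibrated_sub_action M lam A v \<and> (\<forall>i\<in>{1..r}. v (xb i) = w i) \<longrightarrow>
             (\<forall>x\<in>shift_space M. ereal (v x) = ereal (w i0) + peierls M lam A (xb i0) x)))"
proof -
  let ?I = "{1..r}"
  obtain K \<theta> where "holder_subshift M lam A K \<theta>"
    using holder_subshift_exists assms(1-5) by blast
  then interpret holder_subshift M lam A K \<theta> .
  have C: "C i \<in> irreducible_components M lam A" "xb i \<in> C i" if "i \<in> ?I" for i
    using assms(6,9) that by blast+
  have \<Omega>: "xb i \<in> \<Omega>" if "i \<in> ?I" for i using component_members(1)[OF C(1) C(2) C(2)] that by blast
  have in\<Sigma>: "xb i \<in> \<Sigma>" if "i \<in> ?I" for i using nonwandering_in[OF \<Omega>[OF that]] .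
  have pei: "peierls M lam A (xb i) x = ereal (h (xb i) x)" if "i \<in> ?I" "x \<in> \<Sigma>" for i x
    using peierls_eq[OF \<Omega>] that by blast
  have ne: "?I \<noteq> {}" using nonwandering_nonempty assms(8) by (metis UN_empty)
  have constr: "w \<in> constraint_set M lam A r xb \<longleftrightarrow> (\<forall>i\<in>?I. \<forall>j\<in>?I. w j \<le> w i + h (xb i) (xb j))" for w
    by (simp add: constraint_set_def pei in\<Sigma> diff_le_eq add.commute)
  have sub: "u y \<le> u (xb i) + h (xb i) y"
    if "calibrated_sub_action M lam A u" "i \<in> ?I" "y \<in> \<Sigma>" for u i y
    using sub_action_le_h[OF _ \<Omega> that(3), of u i] that unfolding calibrated_iff by (simp add: diff_le_eq add.commute)
  have attained: "\<exists>i\<in>?I. u (xb i) + h (xb i) x \<le> u x"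
    if u: "calibrated_sub_action M lam A u" and x: "x \<in> \<Sigma>" for u x
  proof -
    obtain p where p: "p \<in> \<Omega>" "u p + h p x \<le> u x" using calibrated_attained[OF u x] by blast
    then obtain i where i: "i \<in> ?I" "p \<in> C i" using assms(8) by blast
    \<comment> \<open>The round trip between \<open>xb i\<close> and \<open>p\<close> is free, so
      \<open>p\<close> can be replaced by \<open>xb i\<close> without loss.\<close>
    have "h (xb i) p + h p (xb i) = 0" using component_members(3)[OF C(1) C(2) i(2)] i(1) by blast
    moreover have "u (xb i) - u p \<le> h p (xb i)"
      using sub_action_le_h[OF _ p(1) in\<Sigma>[OF i(1)], of u] u by (simp add: calibrated_sub_action_def)
    moreover have "h (xb i) x \<le> h (xb i) p + h p x" using h_triangle[OF \<Omega>[OF i(1)] p(1) x] .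
    ultimately have "u (xb i) + h (xb i) x \<le> u x" using p(2) by linarith
    then show ?thesis using i(1) by blast
  qed
  have repr: "ereal (u x) = (MIN i\<in>?I. ereal (u (xb i)) + peierls M lam A (xb i) x)"
    if u: "calibrated_sub_action M lam A u" and x: "x \<in> \<Sigma>" for u x
  proof -
    obtain i where i: "i \<in> ?I" "u (xb i) + h (xb i) x \<le> u x" using attained[OF u x] by blast
    show ?thesis
      by (rule Min_image_eq[OF _ _ i(1)]) (use i pei x sub[OF u] in auto)
  qed
  have part1: "(\<lambda>i. u (xb i)) \<in> constraint_set M lam A r xb" if "calibrated_sub_action M lam A u" for u
    using constr sub[OF that] in\<Sigma> by simp
  have part2: "\<exists>u. (\<forall>x\<in>\<Sigma>. ereal (u x) = (MIN i\<in>?I. ereal (w i) + peierls M lam A (xb i) x)) \<and>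
      calibrated_sub_action M lam A u \<and> (\<forall>i\<in>?I. u (xb i) = w i)"
    if w: "w \<in> constraint_set M lam A r xb" for w
  proof -
    define u where "u x = (MIN i\<in>?I. w i + h (xb i) x)" for x
    have cal: "calibrated_sub_action M lam A u"
      unfolding u_def using ne h_calibrated \<Omega> by (intro calibrated_Min) auto
    \<comment> \<open>The term of index \<open>i\<close> equals \<open>w i\<close> by
      \<open>h_self\<close>; membership in the constraint set says that no other term is
      smaller.\<close>
    have ux: "u (xb i) = w i" if i: "i \<in> ?I" for i
      unfolding u_def
      by (rule Min_image_eq[OF _ _ i, symmetric]) (use w constr i h_self[OF \<Omega>[OF i]] in auto)
    have "ereal (u x) = (MIN i\<in>?I. ereal (w i) + peierls M lam A (xb i) x)" if "x \<in> \<Sigma>" for x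
      using repr[OF cal that] ux by (metis (mono_tags, lifting) image_cong)
    then show ?thesis using cal ux by blast
  qed
  have part3: "(\<forall>j\<in>?I. (\<forall>i\<in>?I. ereal (w i) = ereal (w j) + peierls M lam A (xb j) (xb i)) \<longrightarrow> j = i0) \<and>
      w \<in> constraint_set M lam A r xb \<and>
      (\<exists>u. calibrated_sub_action M lam A u \<and> (\<forall>i\<in>?I. u (xb i) = w i) \<and>
        (\<forall>x\<in>\<Sigma>. ereal (u x) = ereal (w i0) + peierls M lam A (xb i0) x)) \<and>
      (\<forall>v. calibrated_sub_action M lam A v \<and> (\<forall>i\<in>?I. v (xb i) = w i) \<longrightarrow>
        (\<forall>x\<in>\<Sigma>. ereal (v x) = ereal (w i0) + peierls M lam A (xb i0) x))"
    if i0: "i0 \<in> ?I" and w: "\<forall>i\<in>?I. ereal (w i) = ereal (w i0) + peierls M lam A (xb i0) (xb i)" for i0 w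
  proof (intro conjI)
    have w': "w i = w i0 + h (xb i0) (xb i)" if "i \<in> ?I" for i
      using bspec[OF w that] unfolding pei[OF i0 in\<Sigma>[OF that]] by simp
    show "\<forall>j\<in>?I. (\<forall>i\<in>?I. ereal (w i) = ereal (w j) + peierls M lam A (xb j) (xb i)) \<longrightarrow> j = i0"
    proof (intro ballI impI)
      fix j assume j: "j \<in> ?I" and wj: "\<forall>i\<in>?I. ereal (w i) = ereal (w j) + peierls M lam A (xb j) (xb i)"
      have "w i0 = w j + h (xb j) (xb i0)" using bspec[OF wj i0] unfolding pei[OF j in\<Sigma>[OF i0]] by simp
      \<comment> \<open>Adding the two relations between \<open>w i0\<close> and \<open>w j\<close>
        places \<open>xb j\<close> in the class \<open>C i0\<close>; disjointness does the
        rest.\<close>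
      then have "h (xb i0) (xb j) + h (xb j) (xb i0) = 0" using w'[OF j] by linarith
      then have "xb j \<in> C i0" using component_closed[OF C[OF i0] \<Omega>[OF j]] by blast
      then show "j = i0" using C(2)[OF j] assms(7) i0 j unfolding disjoint_family_on_def by blast
    qed
    have "w j \<le> w i + h (xb i) (xb j)" if "i \<in> ?I" "j \<in> ?I" for i j
      using w'[OF that(1)] w'[OF that(2)] h_triangle[OF \<Omega>[OF i0] \<Omega>[OF that(1)] in\<Sigma>[OF that(2)]] by linarith
    then show "w \<in> constraint_set M lam A r xb" using constr by blast
    define u where "u x = w i0 + h (xb i0) x" for x
    have cal: "calibrated_sub_action M lam A u"
      unfolding u_def using calibrated_add_const h_calibrated[OF \<Omega>[OF i0]] by blast
    moreover have ux: "\<forall>i\<in>?I. u (xb i) = w i" unfolding u_def using w' by simp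
    moreover have up: "ereal (u x) = ereal (w i0) + peierls M lam A (xb i0) x" if "x \<in> \<Sigma>" for x
      using pei[OF i0 that] by (simp add: u_def)
    ultimately show "\<exists>u. calibrated_sub_action M lam A u \<and> (\<forall>i\<in>?I. u (xb i) = w i) \<and>
        (\<forall>x\<in>\<Sigma>. ereal (u x) = ereal (w i0) + peierls M lam A (xb i0) x)"
      by blast
    show "\<forall>v. calibrated_sub_action M lam A v \<and> (\<forall>i\<in>?I. v (xb i) = w i) \<longrightarrow>
        (\<forall>x\<in>\<Sigma>. ereal (v x) = ereal (w i0) + peierls M lam A (xb i0) x)"
    proof (intro allI impI ballI)
      fix v x assume v: "calibrated_sub_action M lam A v \<and> (\<forall>i\<in>?I. v (xb i) = w i)" and x: "x \<in> \<Sigma>"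
      \<comment> \<open>By \<open>repr\<close>, calibrated sub-actions with equal values at the
        representatives coincide.\<close>
      have "(\<lambda>i. ereal (v (xb i)) + peierls M lam A (xb i) x) ` ?I
          = (\<lambda>i. ereal (u (xb i)) + peierls M lam A (xb i) x) ` ?I"
        using v ux by (intro image_cong) auto
      then have "ereal (v x) = ereal (u x)" using repr[OF conjunct1[OF v] x] repr[OF cal x] by simp
      then show "ereal (v x) = ereal (w i0) + peierls M lam A (xb i0) x" using up[OF x] by simp
    qed
  qed
  show ?thesis using part1 repr part2 part3 by blast
qed

end
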